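(* Let $c'$ be a vector of $d'$ non-negative integers, let $k''$ be a sparsity parameter, and let indices $s \le e$ in $[1,d']$ be such that $e - s + 1 \ge \Delta$ or $e = d'$. Define $c''$ by $c''_i = -\infty$ if $i \in [s,e]$ and $c''_i = c'_i$ otherwise. Assume there is a choice of $k''$ coordinates of $c''$, pairwise at distance at least $\Delta$, none of which has index in $[s,e]$. Then there is an algorithm that outputs non-negative integers $k'_L$ and $k'_R$ with the property that there exists an optimal $\Delta$-separated solution for cost vector $c''$ and sparsity $k''$ which chooses $k'_L$ coordinates of $c''$ with indices less than $s$ and $k'_R$ coordinates with indices greater than $e$. The algorithm runs in time $O(d'(\log c'_{max} + \log k''))$, where $c'_{max} = \max_i c'_i$.
   Context: $\Delta$ is a fixed positive integer. A $\Delta$-separated solution for a cost vector $a \in (\mathbb{R}\cup\{-\infty\})^{d'}$ and sparsity $k$ is a set $S \subseteq [d']$ with $|S| = k$ and $|i-j| \ge \Delta$ for all distinct $i,j\in S$; it is optimal if it maximizes $\sum_{i \in S} a_i$. *)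

theory Defs
  imports "HOL-Library.Extended_Real" Complex_Main
begin

text \<open>A cost vector of dimension \<open>d\<close> is a function on indices of which only the values on
  \<open>{1..d}\<close> matter.  Entries live in \<^typ>\<open>ereal\<close> to allow \<open>-\<infinity>\<close>; the value \<open>+\<infinity>\<close> is never used.\<close>

definition separated_solution :: "nat \<Rightarrow> nat \<Rightarrow> nat \<Rightarrow> nat set \<Rightarrow> bool" where
  "separated_solution \<Delta> d k S \<longleftrightarrow>
     S \<subseteq> {1..d} \<and> card S = k \<and>
     (\<forall>i\<in>S. \<forall>j\<in>S. i \<noteq> j \<longrightarrow> \<bar>int i - int j\<bar> \<ge> int \<Delta>)"

definition optimal_separated_solution ::
    "nat \<Rightarrow> nat \<Rightarrow> (nat \<Rightarrow> ereal) \<Rightarrow> nat \<Rightarrow> nat set \<Rightarrow> bool" where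
  "optimal_separated_solution \<Delta> d a k S \<longleftrightarrow>
     separated_solution \<Delta> d k S \<and>
     (\<forall>T. separated_solution \<Delta> d k T \<longrightarrow> (\<Sum>i\<in>T. a i) \<le> (\<Sum>i\<in>S. a i))"

definition masked_cost :: "(nat \<Rightarrow> nat) \<Rightarrow> nat \<Rightarrow> nat \<Rightarrow> nat \<Rightarrow> ereal" where
  "masked_cost c s e i = (if i \<in> {s..e} then -\<infinity> else ereal (real (c i)))"

text \<open>Algorithms are programs for a word RAM: an integer-indexed memory, finitely many registers
  (those occurring in the program text) and unit-cost operations.  A state consists of the
  register contents and the memory contents.  The parameter \<open>W\<close> below is the largest absolute
  value of a machine word: an execution exists only if every number that is computed or used as
  an address fits into a word, so unit-cost arithmetic on huge numbers is impossible.\<close>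

type_synonym state = "(nat \<Rightarrow> int) \<times> (int \<Rightarrow> int)"

datatype exp =
    Num int
  | Reg nat
  | Load exp
  | Add exp exp
  | Sub exp exp
  | Mul exp exp
  | Div exp exp

datatype bexp =
    Less exp exp
  | Neg bexp
  | Conj bexp bexp

datatype com =
    Skip
  | Assign nat exp
  | Store exp exp
  | Seq com com
  | Cond bexp com com
  | While bexp com

fun val :: "exp \<Rightarrow> state \<Rightarrow> int" where
  "val (Num n) \<sigma> = n"
| "val (Reg x) \<sigma> = fst \<sigma> x"
| "val (Load a) \<sigma> = snd \<sigma> (val a \<sigma>)"
| "val (Add a b) \<sigma> = val a \<sigma> + val b \<sigma>"
| "val (Sub a b) \<sigma> = val a \<sigma> - val b \<sigma>"
| "val (Mul a b) \<sigma> = val a \<sigma> * val b \<sigma>"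
| "val (Div a b) \<sigma> = val a \<sigma> div val b \<sigma>"

fun fits :: "int \<Rightarrow> exp \<Rightarrow> state \<Rightarrow> bool" where
  "fits W (Num n) \<sigma> \<longleftrightarrow> \<bar>n\<bar> \<le> W"
| "fits W (Reg x) \<sigma> \<longleftrightarrow> \<bar>val (Reg x) \<sigma>\<bar> \<le> W"
| "fits W (Load a) \<sigma> \<longleftrightarrow> fits W a \<sigma> \<and> \<bar>val (Load a) \<sigma>\<bar> \<le> W"
| "fits W (Add a b) \<sigma> \<longleftrightarrow> fits W a \<sigma> \<and> fits W b \<sigma> \<and> \<bar>val (Add a b) \<sigma>\<bar> \<le> W"
| "fits W (Sub a b) \<sigma> \<longleftrightarrow> fits W a \<sigma> \<and> fits W b \<sigma> \<and> \<bar>val (Sub a b) \<sigma>\<bar> \<le> W"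
| "fits W (Mul a b) \<sigma> \<longleftrightarrow> fits W a \<sigma> \<and> fits W b \<sigma> \<and> \<bar>val (Mul a b) \<sigma>\<bar> \<le> W"
| "fits W (Div a b) \<sigma> \<longleftrightarrow> fits W a \<sigma> \<and> fits W b \<sigma> \<and> \<bar>val (Div a b) \<sigma>\<bar> \<le> W"

fun cost :: "exp \<Rightarrow> nat" where
  "cost (Num n) = 1"
| "cost (Reg x) = 1"
| "cost (Load a) = 1 + cost a"
| "cost (Add a b) = 1 + cost a + cost b"
| "cost (Sub a b) = 1 + cost a + cost b"
| "cost (Mul a b) = 1 + cost a + cost b"
| "cost (Div a b) = 1 + cost a + cost b"

fun bval :: "bexp \<Rightarrow> state \<Rightarrow> bool" where
  "bval (Less a b) \<sigma> \<longleftrightarrow> val a \<sigma> < val b \<sigma>"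
| "bval (Neg p) \<sigma> \<longleftrightarrow> \<not> bval p \<sigma>"
| "bval (Conj p q) \<sigma> \<longleftrightarrow> bval p \<sigma> \<and> bval q \<sigma>"

fun bfits :: "int \<Rightarrow> bexp \<Rightarrow> state \<Rightarrow> bool" where
  "bfits W (Less a b) \<sigma> \<longleftrightarrow> fits W a \<sigma> \<and> fits W b \<sigma>"
| "bfits W (Neg p) \<sigma> \<longleftrightarrow> bfits W p \<sigma>"
| "bfits W (Conj p q) \<sigma> \<longleftrightarrow> bfits W p \<sigma> \<and> bfits W q \<sigma>"

fun bcost :: "bexp \<Rightarrow> nat" where
  "bcost (Less a b) = 1 + cost a + cost b"
| "bcost (Neg p) = 1 + bcost p"
| "bcost (Conj p q) = 1 + bcost p + bcost q"

text \<open>\<open>exec W P \<sigma> t \<sigma>'\<close>: with word bound \<open>W\<close>, program \<open>P\<close> started in \<open>\<sigma>\<close> halts in \<open>\<sigma>'\<close> after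
  exactly \<open>t\<close> time units.\<close>

inductive exec :: "int \<Rightarrow> com \<Rightarrow> state \<Rightarrow> nat \<Rightarrow> state \<Rightarrow> bool" for W :: int where
  exec_Skip: "exec W Skip \<sigma> 1 \<sigma>"
| exec_Assign: "fits W a \<sigma> \<Longrightarrow>
    exec W (Assign x a) \<sigma> (1 + cost a) ((fst \<sigma>)(x := val a \<sigma>), snd \<sigma>)"
| exec_Store: "fits W a \<sigma> \<Longrightarrow> fits W b \<sigma> \<Longrightarrow>
    exec W (Store a b) \<sigma> (1 + cost a + cost b) (fst \<sigma>, (snd \<sigma>)(val a \<sigma> := val b \<sigma>))"
| exec_Seq: "exec W P \<sigma> t \<sigma>' \<Longrightarrow> exec W Q \<sigma>' u \<sigma>'' \<Longrightarrow> exec W (Seq P Q) \<sigma> (t + u) \<sigma>''"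
| exec_CondT: "bfits W p \<sigma> \<Longrightarrow> bval p \<sigma> \<Longrightarrow> exec W P \<sigma> t \<sigma>' \<Longrightarrow>
    exec W (Cond p P Q) \<sigma> (1 + bcost p + t) \<sigma>'"
| exec_CondF: "bfits W p \<sigma> \<Longrightarrow> \<not> bval p \<sigma> \<Longrightarrow> exec W Q \<sigma> t \<sigma>' \<Longrightarrow>
    exec W (Cond p P Q) \<sigma> (1 + bcost p + t) \<sigma>'"
| exec_WhileF: "bfits W p \<sigma> \<Longrightarrow> \<not> bval p \<sigma> \<Longrightarrow> exec W (While p P) \<sigma> (1 + bcost p) \<sigma>"
| exec_WhileT: "bfits W p \<sigma> \<Longrightarrow> bval p \<sigma> \<Longrightarrow> exec W P \<sigma> t \<sigma>' \<Longrightarrow> exec W (While p P) \<sigma>' u \<sigma>'' \<Longrightarrow>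
    exec W (While p P) \<sigma> (1 + bcost p + t + u) \<sigma>''"

text \<open>Input convention: the scalar inputs \<open>\<Delta>, d, k, s, e\<close> are in registers 0 to 4 and the vector
  \<open>c\<close> is in memory cells \<open>1, \<dots>, d\<close>; everything else is 0.\<close>

definition input_state ::
    "nat \<Rightarrow> nat \<Rightarrow> nat \<Rightarrow> nat \<Rightarrow> nat \<Rightarrow> (nat \<Rightarrow> nat) \<Rightarrow> state" where
  "input_state \<Delta> d k s e c =
     ((\<lambda>_. 0)(0 := int \<Delta>, 1 := int d, 2 := int k, 3 := int s, 4 := int e),
      (\<lambda>a. if 1 \<le> a \<and> a \<le> int d then int (c (nat a)) else 0))"

text \<open>Output convention: the results are left in registers 0 and 1.\<close>

definition outputs :: "state \<Rightarrow> nat \<Rightarrow> nat \<Rightarrow> bool" where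
  "outputs \<sigma> m n \<longleftrightarrow> fst \<sigma> 0 = int m \<and> fst \<sigma> 1 = int n"

end

theory Submission imports Defs begin

text \<open>
  For a penalty \<open>\<mu>\<close> a linear dynamic program maximises \<open>\<Sum>i\<in>S. c i - \<mu>\<close> over separated sets \<open>S\<close> of
  arbitrary size avoiding \<open>[s,e]\<close>, and reports the largest cardinality of a maximiser to the left and to
  the right of \<open>[s,e]\<close>.  An exchange argument shows that the best cost of a separated \<open>k\<close>-set
  is concave in \<open>k\<close> on each side, with integral slopes.  Binary search over the integers in
  \<open>[-k c\<^sub>m\<^sub>a\<^sub>x, c\<^sub>m\<^sub>a\<^sub>x + 1]\<close> finds consecutive penalties \<open>\<mu>\<close> and \<open>\<mu> + 1\<close> whose total
  cardinalities enclose \<open>k\<close>.  On each side, every cardinality between the two reported ones belongs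
  to a maximiser for \<open>\<mu>\<close>, so any split of \<open>k\<close> within these ranges is optimal.
\<close>

subsection \<open>Separated sets and concavity\<close>

text \<open>Tabulating the optima by cardinality would cost a factor of \<open>k\<close>; a penalty
  per chosen coordinate removes the cardinality from the table. In return, the sizes of the
  maximisers jump as the penalty varies, and \<open>k\<close> need not be the reported size for any
  penalty. Integral slopes confine these jumps to integer penalties, which is why two consecutive
  integers suffice and the search needs no fractions. Penalties must go below 0: although the costs
  are non-negative, one more coordinate may force a complete rearrangement and lower the total, by
  up to \<open>k\<close> times the largest cost. The two sides interact only through the common
  penalty, since the masked block keeps them at distance at least \<Delta> unless the right side is
  empty. A table entry is a single integer: its residue modulo \<open>d + 1\<close> holds a size,
  its quotient the penalised cost.\<close>

definition separated :: "nat \<Rightarrow> nat set \<Rightarrow> bool" where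
  "separated \<Delta> S \<longleftrightarrow> (\<forall>i\<in>S. \<forall>j\<in>S. i < j \<longrightarrow> i + \<Delta> \<le> j)"

definition separated_subsets :: "nat \<Rightarrow> nat set \<Rightarrow> nat set set" where
  "separated_subsets \<Delta> D = {S. S \<subseteq> D \<and> separated \<Delta> S}"

definition opt :: "nat \<Rightarrow> (nat \<Rightarrow> int) \<Rightarrow> nat set \<Rightarrow> int" where
  "opt \<Delta> w D = Max (sum w ` separated_subsets \<Delta> D)"

text \<open>The maximum of an empty family is unspecified, so facts about \<open>best\<close> at a
  size come with a separated set at least that large; its subsets realise all smaller sizes.\<close>

definition best :: "nat \<Rightarrow> (nat \<Rightarrow> int) \<Rightarrow> nat set \<Rightarrow> nat \<Rightarrow> int" where
  "best \<Delta> c D k = Max (sum c ` {S \<in> separated_subsets \<Delta> D. card S = k})"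

lemma separated_subset: "separated \<Delta> S \<Longrightarrow> T \<subseteq> S \<Longrightarrow> separated \<Delta> T"
  by (auto simp: separated_def)

lemma separated_union:
  assumes "separated \<Delta> S" "separated \<Delta> T" "\<And>i j. i \<in> S \<Longrightarrow> j \<in> T \<Longrightarrow> i < j \<and> i + \<Delta> \<le> j"
  shows "separated \<Delta> (S \<union> T)"
  using assms unfolding separated_def by (meson UnE less_asym')

lemma separated_solution_iff:
  "separated_solution \<Delta> d k S \<longleftrightarrow> S \<subseteq> {1..d} \<and> card S = k \<and> separated \<Delta> S"
proof -
  have "separated \<Delta> S \<longleftrightarrow> (\<forall>i\<in>S. \<forall>j\<in>S. i \<noteq> j \<longrightarrow> \<bar>int i - int j\<bar> \<ge> int \<Delta>)"
  proof
    assume sep: "separated \<Delta> S"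
    show "\<forall>i\<in>S. \<forall>j\<in>S. i \<noteq> j \<longrightarrow> \<bar>int i - int j\<bar> \<ge> int \<Delta>"
    proof (intro ballI impI)
      fix i j assume "i \<in> S" "j \<in> S" "i \<noteq> j"
      then have "i + \<Delta> \<le> j \<or> j + \<Delta> \<le> i"
        using sep unfolding separated_def by (meson linorder_neqE_nat)
      then show "\<bar>int i - int j\<bar> \<ge> int \<Delta>" by linarith
    qed
  next
    assume far: "\<forall>i\<in>S. \<forall>j\<in>S. i \<noteq> j \<longrightarrow> \<bar>int i - int j\<bar> \<ge> int \<Delta>"
    show "separated \<Delta> S"
      unfolding separated_def
    proof (intro ballI impI)
      fix i j assume "i \<in> S" "j \<in> S" "i < j"
      then have "\<bar>int i - int j\<bar> \<ge> int \<Delta>" using far by (metis less_irrefl)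
      then show "i + \<Delta> \<le> j" using \<open>i < j\<close> by linarith
    qed
  qed
  then show ?thesis by (simp add: separated_solution_def)
qed

lemma finite_separated_subsets: "finite D \<Longrightarrow> finite (separated_subsets \<Delta> D)"
  by (simp add: separated_subsets_def)

lemma empty_in_separated_subsets: "{} \<in> separated_subsets \<Delta> D"
  by (simp add: separated_subsets_def separated_def)

lemma opt_ge: "finite D \<Longrightarrow> S \<in> separated_subsets \<Delta> D \<Longrightarrow> sum w S \<le> opt \<Delta> w D"
  unfolding opt_def by (intro Max_ge) (auto simp: finite_separated_subsets)

lemma opt_attained:
  assumes "finite D"
  obtains S where "S \<in> separated_subsets \<Delta> D" "sum w S = opt \<Delta> w D"
proof -
  have "opt \<Delta> w D \<in> sum w ` separated_subsets \<Delta> D"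
    unfolding opt_def using assms empty_in_separated_subsets[of \<Delta> D]
    by (intro Max_in) (auto simp: finite_separated_subsets)
  then show thesis using that by auto
qed

lemma best_ge:
  "finite D \<Longrightarrow> S \<in> separated_subsets \<Delta> D \<Longrightarrow> sum c S \<le> best \<Delta> c D (card S)"
  unfolding best_def by (intro Max_ge) (auto simp: finite_separated_subsets)

lemma subset_of_card:
  assumes "T \<in> separated_subsets \<Delta> D" "k \<le> card T"
  obtains U where "U \<in> separated_subsets \<Delta> D" "card U = k"
proof -
  obtain U where "U \<subseteq> T" "card U = k"
    using obtain_subset_with_card_n[OF assms(2)] by metis
  then show thesis
    using that assms(1) by (auto simp: separated_subsets_def intro: separated_subset)
qed

lemma best_attained:
  assumes "finite D" "T \<in> separated_subsets \<Delta> D" "k \<le> card T"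
  obtains S where "S \<in> separated_subsets \<Delta> D" "card S = k" "sum c S = best \<Delta> c D k"
proof -
  obtain U where "U \<in> {S \<in> separated_subsets \<Delta> D. card S = k}"
    using subset_of_card[OF assms(2,3)] by auto
  then have "best \<Delta> c D k \<in> sum c ` {S \<in> separated_subsets \<Delta> D. card S = k}"
    unfolding best_def using finite_separated_subsets[OF assms(1), of \<Delta>]
    by (intro Max_in) auto
  then show thesis using that by auto
qed

text \<open>Swap the tails of the two lists at the first index where the entry of \<open>ys\<close> is at least
  \<open>\<Delta>\<close> below that of \<open>xs\<close>; the tail of \<open>ys\<close> is cut one position later, which transfers exactly one element.\<close>

lemma swap_tails:
  fixes xs ys :: "nat list"
  assumes xs: "sorted_wrt (\<lambda>x y. x + \<Delta> \<le> y) xs" and ys: "sorted_wrt (\<lambda>x y. x + \<Delta> \<le> y) ys"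
    and len: "length xs + 2 \<le> length ys"
  obtains j where "j \<le> length xs"
    "sorted_wrt (\<lambda>x y. x + \<Delta> \<le> y) (take j xs @ drop (Suc j) ys)"
    "sorted_wrt (\<lambda>x y. x + \<Delta> \<le> y) (take (Suc j) ys @ drop j xs)"
proof -
  \<comment> \<open>The alternative \<open>j = length xs\<close> guarantees that a cut exists; there
    \<open>drop j xs\<close> is empty and the second list has no junction to check.\<close>
  define P where "P j \<longleftrightarrow> j = length xs \<or> ys ! j + \<Delta> \<le> xs ! j" for j
  define j where "j = (LEAST j. P j)"
  have "P (length xs)" by (simp add: P_def)
  then have j: "P j" "j \<le> length xs"
    unfolding j_def by (auto intro: LeastI Least_le)
  have below: "\<not> P i" if "i < j" for i
    using that not_less_Least unfolding j_def by blast
  have mono: "zs ! p \<le> zs ! q" if "sorted_wrt (\<lambda>x y. x + \<Delta> \<le> y) zs" "p \<le> q" "q < length zs"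
    for zs :: "nat list" and p q
    using sorted_wrt_nth_less[OF that(1), of p q] that by (cases "p = q") auto
  have step: "zs ! p + \<Delta> \<le> zs ! q" if "sorted_wrt (\<lambda>x y. x + \<Delta> \<le> y) zs" "p < q" "q < length zs"
    for zs :: "nat list" and p q
    using sorted_wrt_nth_less[OF that] .
  have "x + \<Delta> \<le> y" if x: "x \<in> set (take j xs)" and y: "y \<in> set (drop (Suc j) ys)" for x y
  proof -
    obtain p where p: "p < j" "x = xs ! p"
      using x j(2) by (auto simp: in_set_conv_nth)
    obtain q where q: "Suc j \<le> q" "q < length ys" "y = ys ! q"
      using y by (auto simp: in_set_conv_nth) (metis add.commute le_add1 less_diff_conv add_Suc_right add_Suc)
    \<comment> \<open>Minimality of \<open>j\<close> leaves a slack of \<Delta> between the lists.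
      The later cut in \<open>ys\<close> pays for it: from index \<open>p\<close> to
      \<open>q\<close> there are two gaps of at least \<Delta>, one absorbing the slack and one
      providing the separation.\<close>
    have "xs ! p < ys ! p + \<Delta>"
      using below[OF p(1)] by (simp add: P_def)
    also have "ys ! p + \<Delta> \<le> ys ! j"
      using step[OF ys, of p j] p(1) j(2) len by linarith
    finally show ?thesis
      using step[OF ys, of j q] p q by linarith
  qed
  moreover have "x + \<Delta> \<le> y" if x: "x \<in> set (take (Suc j) ys)" and y: "y \<in> set (drop j xs)" for x y
  proof -
    obtain p where p: "p \<le> j" "x = ys ! p"
      using x j(2) len by (auto simp: in_set_conv_nth less_Suc_eq_le)
    obtain q where q: "j \<le> q" "q < length xs" "y = xs ! q"
      using y by (auto simp: in_set_conv_nth) (metis add.commute le_add1 less_diff_conv)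
    have "ys ! j + \<Delta> \<le> xs ! j"
      using j(1) q by (auto simp: P_def)
    then show ?thesis
      using mono[OF ys, of p j] mono[OF xs, of j q] p q len by linarith
  qed
  ultimately show thesis
    using that[OF j(2)] xs ys
    by (simp add: sorted_wrt_append sorted_wrt_take sorted_wrt_drop)
qed

lemma sorted_wrt_separated:
  assumes "1 \<le> \<Delta>" "sorted_wrt (\<lambda>x y. x + \<Delta> \<le> y) xs"
  shows "separated \<Delta> (set xs)" "distinct xs"
proof -
  have less: "xs ! p + \<Delta> \<le> xs ! q" if "p < q" "q < length xs" for p q
    using sorted_wrt_nth_less[OF assms(2) that] .
  show "separated \<Delta> (set xs)"
    unfolding separated_def
  proof (intro ballI impI)
    fix x y assume "x \<in> set xs" "y \<in> set xs" "x < y"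
    then obtain p q where "p < length xs" "q < length xs" "x = xs ! p" "y = xs ! q"
      by (auto simp: in_set_conv_nth)
    then show "x + \<Delta> \<le> y"
      using less[of p q] less[of q p] \<open>x < y\<close> by (cases p q rule: linorder_cases) auto
  qed
  have "sorted_wrt (<) xs"
    using sorted_wrt_mono_rel[OF _ assms(2), of "(<)"] assms(1) by auto
  then show "distinct xs" by (simp add: strict_sorted_iff)
qed

text \<open>Swapping tails only regroups the elements of the two sets, so the total cost is
  preserved whatever \<open>c\<close> is; the place of the cut depends on positions alone.\<close>

lemma exchange:
  assumes "1 \<le> \<Delta>" "finite D" and A: "A \<in> separated_subsets \<Delta> D" and B: "B \<in> separated_subsets \<Delta> D"
    and card: "card A + 2 \<le> card B"
  obtains A' B' where "A' \<in> separated_subsets \<Delta> D" "B' \<in> separated_subsets \<Delta> D"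
    "card A' = card A + 1" "card B' = card B - 1" "sum c A' + sum c B' = sum c A + (sum c B :: int)"
proof -
  let ?R = "\<lambda>x y. x + \<Delta> \<le> y"
  have fin: "finite A" "finite B"
    using A B assms(2) by (auto simp: separated_subsets_def intro: finite_subset)
  have sorted: "sorted_wrt ?R (sorted_list_of_set S)" if "separated \<Delta> S" "finite S" for S
    by (rule sorted_wrt_mono_rel[OF _ strict_sorted_list_of_set])
       (use that in \<open>auto simp: separated_def\<close>)
  define xs ys where "xs = sorted_list_of_set A" and "ys = sorted_list_of_set B"
  have sepAB: "separated \<Delta> A" "separated \<Delta> B"
    using A B by (auto simp: separated_subsets_def)
  have xs: "sorted_wrt ?R xs" "set xs = A" "length xs = card A" "distinct xs"
    using sorted[OF sepAB(1) fin(1)] fin(1) by (simp_all add: xs_def)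
  have ys: "sorted_wrt ?R ys" "set ys = B" "length ys = card B" "distinct ys"
    using sorted[OF sepAB(2) fin(2)] fin(2) by (simp_all add: ys_def)
  obtain j where j: "j \<le> length xs" "sorted_wrt ?R (take j xs @ drop (Suc j) ys)"
      "sorted_wrt ?R (take (Suc j) ys @ drop j xs)"
    using swap_tails[OF xs(1) ys(1)] card xs(3) ys(3) by metis
  let ?u = "take (Suc j) ys @ drop j xs" and ?v = "take j xs @ drop (Suc j) ys"
  note sep = sorted_wrt_separated[OF assms(1) j(2)] sorted_wrt_separated[OF assms(1) j(3)]
  have sub: "set ?u \<subseteq> D" "set ?v \<subseteq> D"
    using A B xs(2) ys(2) set_take_subset set_drop_subset
    by (auto simp: separated_subsets_def dest: in_set_takeD in_set_dropD)
  have sums: "sum c (set zs) = sum_list (map c zs)" if "distinct zs" for zs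
    using that by (simp add: sum_list_distinct_conv_sum_set)
  have split: "sum_list (map c zs) = sum_list (map c (take i zs)) + sum_list (map c (drop i zs))" for i zs
    by (metis append_take_drop_id map_append sum_list_append)
  have "sum c (set ?u) + sum c (set ?v) = sum_list (map c xs) + sum_list (map c ys)"
    using sums[OF sep(2)] sums[OF sep(4)] split[of xs j] split[of ys "Suc j"] by simp
  also have "\<dots> = sum c A + sum c B"
    using sums[OF xs(4)] sums[OF ys(4)] xs(2) ys(2) by simp
  finally have "sum c (set ?u) + sum c (set ?v) = sum c A + sum c B" .
  moreover have "card (set ?u) = card A + 1" "card (set ?v) = card B - 1"
    using distinct_card[OF sep(2)] distinct_card[OF sep(4)] j(1) xs(3) ys(3) card by simp_all
  moreover have "set ?u \<in> separated_subsets \<Delta> D" "set ?v \<in> separated_subsets \<Delta> D"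
    using sub sep(1,3) unfolding separated_subsets_def by blast+
  ultimately show thesis using that by blast
qed

text \<open>Optimal sets of sizes \<open>k\<close> and \<open>k + 2\<close> exchange into two sets
  of size \<open>k + 1\<close>. The witness \<open>T\<close> makes all three maxima range over
  non-empty families.\<close>

lemma best_concave:
  assumes "1 \<le> \<Delta>" "finite D" "T \<in> separated_subsets \<Delta> D" "k + 2 \<le> card T"
  shows "best \<Delta> c D k + best \<Delta> c D (k + 2) \<le> 2 * best \<Delta> c D (k + 1)"
proof -
  obtain A where A: "A \<in> separated_subsets \<Delta> D" "card A = k" "sum c A = best \<Delta> c D k"
    using best_attained[OF assms(2,3), of k c] assms(4) by auto
  obtain B where B: "B \<in> separated_subsets \<Delta> D" "card B = k + 2" "sum c B = best \<Delta> c D (k + 2)"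
    using best_attained[OF assms(2,3,4), of c] by auto
  obtain A' B' where "A' \<in> separated_subsets \<Delta> D" "B' \<in> separated_subsets \<Delta> D"
    "card A' = k + 1" "card B' = k + 1" "sum c A' + sum c B' = sum c A + sum c B"
    using exchange[OF assms(1,2) A(1) B(1), of c] A(2) B(2) by auto
  then show ?thesis
    using best_ge[OF assms(2), of A' \<Delta> c] best_ge[OF assms(2), of B' \<Delta> c] A(3) B(3) by auto
qed

section \<open>Sizes that are optimal for a given penalty\<close>

definition penalised_max :: "nat \<Rightarrow> (nat \<Rightarrow> int) \<Rightarrow> nat set \<Rightarrow> int \<Rightarrow> nat \<Rightarrow> bool" where
  "penalised_max \<Delta> c D \<mu> k \<longleftrightarrow>
     (\<exists>T \<in> separated_subsets \<Delta> D. card T = k) \<and>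
     (\<forall>T \<in> separated_subsets \<Delta> D.
        best \<Delta> c D (card T) - \<mu> * int (card T) \<le> best \<Delta> c D k - \<mu> * int k)"

text \<open>In terms of the concave function \<open>best\<close>, \<open>penalised_max\<close> says
  that \<mu> is a supergradient at \<open>k\<close>, and several sizes can share one. Singling out
  the largest makes the size a function of \<mu>, which a search can compare with a target.\<close>

definition largest_penalised_max :: "nat \<Rightarrow> (nat \<Rightarrow> int) \<Rightarrow> nat set \<Rightarrow> int \<Rightarrow> nat \<Rightarrow> bool" where
  "largest_penalised_max \<Delta> c D \<mu> k \<longleftrightarrow>
     penalised_max \<Delta> c D \<mu> k \<and>
     (\<forall>T \<in> separated_subsets \<Delta> D. k < card T \<longrightarrow>
        best \<Delta> c D (card T) - \<mu> * int (card T) < best \<Delta> c D k - \<mu> * int k)"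

text \<open>If \<open>p\<close> exceeded \<open>n\<close>, the gain in \<open>best\<close> from
  \<open>n\<close> to \<open>p\<close> would be below \<open>\<mu> * (p - n)\<close> by the choice
  of \<open>n\<close>, yet at least \<open>(\<mu> + 1) * (p - n)\<close> by the choice of
  \<open>p\<close>.\<close>

lemma largest_penalised_max_antimono:
  assumes "largest_penalised_max \<Delta> c D \<mu> n" "largest_penalised_max \<Delta> c D (\<mu> + 1) p"
  shows "p \<le> n"
proof (rule ccontr)
  assume "\<not> p \<le> n"
  moreover obtain P where P: "P \<in> separated_subsets \<Delta> D" "card P = p"
    using assms(2) by (auto simp: largest_penalised_max_def penalised_max_def)
  moreover obtain N where N: "N \<in> separated_subsets \<Delta> D" "card N = n"
    using assms(1) by (auto simp: largest_penalised_max_def penalised_max_def)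
  ultimately have "best \<Delta> c D p - \<mu> * int p < best \<Delta> c D n - \<mu> * int n"
    "best \<Delta> c D n - (\<mu> + 1) * int n \<le> best \<Delta> c D p - (\<mu> + 1) * int p"
    using assms unfolding largest_penalised_max_def penalised_max_def by auto
  then show False using \<open>\<not> p \<le> n\<close> by (simp add: algebra_simps)
qed

text \<open>Since the costs are integral, the slopes of the concave function \<open>best\<close> between the
  two cardinalities \<open>p\<close> and \<open>n\<close> are all equal to \<open>\<mu>\<close>.\<close>

lemma penalised_max_between:
  assumes "1 \<le> \<Delta>" "finite D"
    and n: "largest_penalised_max \<Delta> c D \<mu> n" and p: "largest_penalised_max \<Delta> c D (\<mu> + 1) p"
    and k: "p \<le> k" "k \<le> n"
  shows "penalised_max \<Delta> c D \<mu> k"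
proof -
  define G where "G k = best \<Delta> c D k - \<mu> * int k" for k
  obtain T where T: "T \<in> separated_subsets \<Delta> D" "card T = n"
    using n by (auto simp: largest_penalised_max_def penalised_max_def)
  have dec: "G (Suc i) \<le> G i" if "p \<le> i" "Suc i \<le> n" for i
    using that
  proof (induction i rule: dec_induct)
    case base
    obtain U where "U \<in> separated_subsets \<Delta> D" "card U = Suc p"
      using subset_of_card[OF T(1)] T(2) base by metis
    then have "best \<Delta> c D (Suc p) - (\<mu> + 1) * int (Suc p) < best \<Delta> c D p - (\<mu> + 1) * int p"
      using p unfolding largest_penalised_max_def by (metis lessI)
    \<comment> \<open>Integrality enters here: a slope strictly below \<open>\<mu> + 1\<close> is at
      most \<mu>. The induction step passes this bound on by concavity.\<close>
    then show ?case by (simp add: G_def algebra_simps)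
  next
    case (step i)
    then have "best \<Delta> c D i + best \<Delta> c D (i + 2) \<le> 2 * best \<Delta> c D (i + 1)"
      using best_concave[OF assms(1,2) T(1)] T(2) by simp
    then have "G i + G (Suc (Suc i)) \<le> 2 * G (Suc i)"
      by (simp add: G_def algebra_simps)
    then show ?case using step by simp
  qed
  \<comment> \<open>\<open>G\<close> does not increase from \<open>p\<close> to \<open>n\<close>,
    while its global maximum is at \<open>n\<close>; hence it is constant in between.\<close>
  have "G n \<le> G i" if "i \<le> n" "p \<le> i" for i
    using that
  proof (induction i rule: inc_induct)
    case (step i)
    then show ?case using dec[of i] by force
  qed simp
  then have "G n \<le> G k" using k by blast
  moreover obtain U where "U \<in> separated_subsets \<Delta> D" "card U = k"
    using subset_of_card[OF T(1)] T(2) k(2) by metis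
  moreover have "G (card V) \<le> G n" if "V \<in> separated_subsets \<Delta> D" for V
    using n that unfolding largest_penalised_max_def penalised_max_def G_def by blast
  ultimately show ?thesis
    unfolding penalised_max_def G_def by (blast intro: order_trans)
qed


text \<open>The summand \<open>1\<close> in the weights breaks ties in favour of large sets; as \<open>M\<close> exceeds every
  cardinality, the cardinality of the optimum is the remainder of its value modulo \<open>M\<close>.\<close>

lemma card_opt:
  fixes c :: "nat \<Rightarrow> int" and \<mu> :: int and \<Delta> :: nat
  assumes D: "finite D" "card D < M"
  defines "v \<equiv> opt \<Delta> (\<lambda>i. int M * (c i - \<mu>) + 1) D"
  shows "largest_penalised_max \<Delta> c D \<mu> (nat (v mod int M))"
proof -
  define G where "G k = best \<Delta> c D k - \<mu> * int k" for k
  have weight: "(\<Sum>i\<in>S. int M * (c i - \<mu>) + 1) = int M * (sum c S - \<mu> * int (card S)) + int (card S)"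
    for S
    by (simp add: sum.distrib sum_distrib_left[symmetric] sum_subtractf mult.commute)
  have card: "card S < M" if "S \<in> separated_subsets \<Delta> D" for S
    using that card_mono[OF D(1), of S] D(2) by (auto simp: separated_subsets_def)
  obtain S where S: "S \<in> separated_subsets \<Delta> D" "v = int M * (sum c S - \<mu> * int (card S)) + int (card S)"
    using opt_attained[OF D(1)] weight unfolding v_def by metis
  have le: "int M * G (card T) + int (card T) \<le> int M * G (card S) + int (card S)"
    if T: "T \<in> separated_subsets \<Delta> D" for T
  proof -
    obtain U where U: "U \<in> separated_subsets \<Delta> D" "card U = card T" "sum c U = best \<Delta> c D (card T)"
      using best_attained[OF D(1) T order_refl] by metis
    have "int M * G (card T) + int (card T) \<le> v"
      using opt_ge[OF D(1) U(1), of "\<lambda>i. int M * (c i - \<mu>) + 1"] U(2,3)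
      unfolding v_def[symmetric] weight G_def by simp
    also have "\<dots> \<le> int M * G (card S) + int (card S)"
      using best_ge[OF D(1) S(1), of c] unfolding S(2) G_def by (simp add: mult_left_mono)
    finally show ?thesis .
  qed
  have G: "G (card T) \<le> G (card S)" if T: "T \<in> separated_subsets \<Delta> D" for T
  proof (rule ccontr)
    assume "\<not> G (card T) \<le> G (card S)"
    \<comment> \<open>An excess of the integer \<open>G\<close> is at least 1, hence worth at least
      \<open>M\<close>, which the tie-breaking term \<open>card S < M\<close> cannot offset.\<close>
    then have "int M * (G (card S) + 1) \<le> int M * G (card T)"
      by (intro mult_left_mono) auto
    then show False
      using le[OF T] card[OF S(1)] by (simp add: algebra_simps)
  qed
  have G_strict: "G (card T) < G (card S)"
    if T: "T \<in> separated_subsets \<Delta> D" "card S < card T" for T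
  proof -
    have "G (card T) \<noteq> G (card S)"
      using le[OF T(1)] T(2) by auto
    then show ?thesis using G[OF T(1)] by simp
  qed
  have "v mod int M = int (card S)"
    using card[OF S(1)] by (simp add: S(2))
  then have nat_mod: "nat (v mod int M) = card S" by simp
  show ?thesis
    using S(1) G G_strict unfolding nat_mod largest_penalised_max_def penalised_max_def G_def by blast
qed

subsection \<open>Recursion and bounds\<close>

lemma opt_empty: "opt \<Delta> w {} = 0"
  by (simp add: opt_def separated_subsets_def separated_def)

text \<open>As \<open>n\<close> is the largest index, choosing it restricts the rest only to indices
  at most \<open>n - \<Delta>\<close>. For a prefix with a block removed, this is again such a set,
  so prefixes index the table.\<close>

lemma opt_insert_last:
  assumes fin: "finite D" and less: "\<And>i. i \<in> D \<Longrightarrow> i < n"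
  shows "opt \<Delta> w (insert n D) = max (opt \<Delta> w D) (opt \<Delta> w {i \<in> D. i + \<Delta> \<le> n} + w n)"
proof (rule antisym)
  have "n \<notin> D" using less by blast
  obtain S where S: "S \<in> separated_subsets \<Delta> (insert n D)" "sum w S = opt \<Delta> w (insert n D)"
    using opt_attained[of "insert n D"] fin by auto
  show "opt \<Delta> w (insert n D) \<le> max (opt \<Delta> w D) (opt \<Delta> w {i \<in> D. i + \<Delta> \<le> n} + w n)"
  proof (cases "n \<in> S")
    case True
    have "S - {n} \<in> separated_subsets \<Delta> {i \<in> D. i + \<Delta> \<le> n}"
      using S(1) True less
      by (auto simp: separated_subsets_def separated_def)
    then have "sum w (S - {n}) \<le> opt \<Delta> w {i \<in> D. i + \<Delta> \<le> n}"
      using opt_ge fin by simp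
    moreover have "finite S"
      using S(1) fin by (auto simp: separated_subsets_def intro: finite_subset)
    then have "sum w S = w n + sum w (S - {n})"
      using True by (simp add: sum.remove)
    ultimately show ?thesis using S(2) by simp
  next
    case False
    then have "S \<in> separated_subsets \<Delta> D"
      using S(1) by (auto simp: separated_subsets_def)
    then show ?thesis using opt_ge[OF fin] S(2) by (metis max.coboundedI1)
  qed
  obtain S where S: "S \<in> separated_subsets \<Delta> D" "sum w S = opt \<Delta> w D"
    using opt_attained[OF fin] by auto
  have "opt \<Delta> w D \<le> opt \<Delta> w (insert n D)"
    using opt_ge[of "insert n D" S \<Delta> w] S fin by (auto simp: separated_subsets_def)
  moreover obtain T where T: "T \<in> separated_subsets \<Delta> {i \<in> D. i + \<Delta> \<le> n}"
      "sum w T = opt \<Delta> w {i \<in> D. i + \<Delta> \<le> n}"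
    using opt_attained[of "{i \<in> D. i + \<Delta> \<le> n}"] fin by auto
  have "separated \<Delta> (T \<union> {n})"
    by (rule separated_union) (use T less in \<open>auto simp: separated_subsets_def separated_def\<close>)
  then have "insert n T \<in> separated_subsets \<Delta> (insert n D)"
    using T(1) by (auto simp: separated_subsets_def)
  then have "sum w (insert n T) \<le> opt \<Delta> w (insert n D)"
    using opt_ge fin by simp
  moreover have "finite T" "n \<notin> T"
    using T(1) fin \<open>n \<notin> D\<close> by (auto simp: separated_subsets_def intro: finite_subset)
  ultimately show "max (opt \<Delta> w D) (opt \<Delta> w {i \<in> D. i + \<Delta> \<le> n} + w n) \<le> opt \<Delta> w (insert n D)"
    using T(2) by simp
qed

text \<open>This lets one pass serve both sides: the optimum on the right becomes the difference of
  two table entries.\<close>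

lemma opt_union:
  assumes fin: "finite L" "finite R" and far: "\<And>i j. i \<in> L \<Longrightarrow> j \<in> R \<Longrightarrow> i < j \<and> i + \<Delta> \<le> j"
  shows "opt \<Delta> w (L \<union> R) = opt \<Delta> w L + opt \<Delta> w R"
proof (rule antisym)
  have disj: "L \<inter> R = {}" using far by blast
  obtain S where S: "S \<in> separated_subsets \<Delta> (L \<union> R)" "sum w S = opt \<Delta> w (L \<union> R)"
    using opt_attained[of "L \<union> R"] fin by auto
  have "S \<inter> L \<in> separated_subsets \<Delta> L" "S \<inter> R \<in> separated_subsets \<Delta> R"
    using S(1) by (auto simp: separated_subsets_def intro: separated_subset)
  then have "sum w (S \<inter> L) + sum w (S \<inter> R) \<le> opt \<Delta> w L + opt \<Delta> w R"
    using opt_ge fin by (intro add_mono) auto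
  moreover have "sum w ((S \<inter> L) \<union> (S \<inter> R)) = sum w (S \<inter> L) + sum w (S \<inter> R)"
    using fin disj by (intro sum.union_disjoint) auto
  moreover have "(S \<inter> L) \<union> (S \<inter> R) = S"
    using S(1) by (auto simp: separated_subsets_def)
  ultimately show "opt \<Delta> w (L \<union> R) \<le> opt \<Delta> w L + opt \<Delta> w R" using S(2) by simp
next
  have disj: "L \<inter> R = {}" using far by blast
  obtain S where S: "S \<in> separated_subsets \<Delta> L" "sum w S = opt \<Delta> w L"
    using opt_attained[OF fin(1)] by auto
  obtain T where T: "T \<in> separated_subsets \<Delta> R" "sum w T = opt \<Delta> w R"
    using opt_attained[OF fin(2)] by auto
  have "separated \<Delta> (S \<union> T)"
    by (rule separated_union) (use S(1) T(1) far in \<open>auto simp: separated_subsets_def\<close>)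
  then have "S \<union> T \<in> separated_subsets \<Delta> (L \<union> R)"
    using S(1) T(1) by (auto simp: separated_subsets_def)
  then have "sum w (S \<union> T) \<le> opt \<Delta> w (L \<union> R)"
    using opt_ge fin by simp
  moreover have "sum w (S \<union> T) = sum w S + sum w T"
    using S(1) T(1) fin disj
    by (intro sum.union_disjoint) (auto simp: separated_subsets_def intro: finite_subset)
  ultimately show "opt \<Delta> w L + opt \<Delta> w R \<le> opt \<Delta> w (L \<union> R)" using S(2) T(2) by simp
qed

lemma opt_nonneg: "finite D \<Longrightarrow> 0 \<le> opt \<Delta> w D"
  using opt_ge[OF _ empty_in_separated_subsets, of D w \<Delta>] by simp

lemma opt_le:
  assumes "finite D" "\<And>i. i \<in> D \<Longrightarrow> w i \<le> b" "0 \<le> b"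
  shows "opt \<Delta> w D \<le> int (card D) * b"
proof -
  obtain S where S: "S \<in> separated_subsets \<Delta> D" "sum w S = opt \<Delta> w D"
    using opt_attained[OF assms(1)] by auto
  have "S \<subseteq> D" using S(1) by (simp add: separated_subsets_def)
  have "sum w S \<le> int (card S) * b"
    using sum_bounded_above[of S w b] assms(2) \<open>S \<subseteq> D\<close> by auto
  also have "\<dots> \<le> int (card D) * b"
    using card_mono[OF assms(1) \<open>S \<subseteq> D\<close>] assms(3) by (simp add: mult_right_mono)
  finally show ?thesis using S(2) by simp
qed

lemma best_bounds:
  assumes "finite D" "\<And>i. i \<in> D \<Longrightarrow> 0 \<le> c i \<and> c i \<le> b" "T \<in> separated_subsets \<Delta> D" "k \<le> card T"
  shows "0 \<le> best \<Delta> c D k" "best \<Delta> c D k \<le> int k * b"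
proof -
  obtain S where S: "S \<in> separated_subsets \<Delta> D" "card S = k" "sum c S = best \<Delta> c D k"
    using best_attained[OF assms(1,3,4)] by metis
  then have "S \<subseteq> D" by (simp add: separated_subsets_def)
  then show "0 \<le> best \<Delta> c D k" "best \<Delta> c D k \<le> int k * b"
    using sum_bounded_above[of S c b] sum_nonneg[of S c] assms(2) S(2,3) by auto
qed

text \<open>Each chosen index loses at least 1, so only the empty set is a maximiser. This gives the
  upper end of the search.\<close>

lemma largest_penalised_max_high_penalty:
  assumes "finite D" "\<And>i. i \<in> D \<Longrightarrow> 0 \<le> c i \<and> c i \<le> b" "largest_penalised_max \<Delta> c D (b + 1) k"
  shows "k = 0"
proof -
  obtain T where T: "T \<in> separated_subsets \<Delta> D" "card T = k"
    using assms(3) by (auto simp: largest_penalised_max_def penalised_max_def)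
  have "\<forall>T \<in> separated_subsets \<Delta> D.
      best \<Delta> c D (card T) - (b + 1) * int (card T) \<le> best \<Delta> c D k - (b + 1) * int k"
    using assms(3) unfolding largest_penalised_max_def penalised_max_def by blast
  from bspec[OF this empty_in_separated_subsets] have "best \<Delta> c D 0 \<le> best \<Delta> c D k - (b + 1) * int k" by simp
  moreover have "0 \<le> best \<Delta> c D 0" "best \<Delta> c D k \<le> int k * b"
    using best_bounds[OF assms(1,2) T(1)] T(2) by auto
  ultimately show ?thesis by (simp add: algebra_simps)
qed

text \<open>Growing from \<open>k\<close> to \<open>k + 1\<close> elements may replace all of them,
  but loses at most \<open>k * b\<close>. The reward \<open>m * b\<close> for the new element makes
  up for that, and ties favour the larger size, so a reported size up to \<open>m\<close> can only
  be the largest possible one.\<close>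

lemma largest_penalised_max_low_penalty:
  assumes "finite D" "\<And>i. i \<in> D \<Longrightarrow> 0 \<le> c i \<and> c i \<le> b" "0 \<le> b"
    and k: "largest_penalised_max \<Delta> c D (- int m * b) k" "k \<le> m"
    and T: "T \<in> separated_subsets \<Delta> D"
  shows "card T \<le> k"
proof (rule ccontr)
  assume "\<not> card T \<le> k"
  then obtain U where U: "U \<in> separated_subsets \<Delta> D" "card U = Suc k"
    using subset_of_card[OF T, of "Suc k"] by auto
  have "best \<Delta> c D (Suc k) - (- int m * b) * int (Suc k) < best \<Delta> c D k - (- int m * b) * int k"
    using k(1) U unfolding largest_penalised_max_def by (metis lessI)
  then have "best \<Delta> c D (Suc k) + int m * b < best \<Delta> c D k"
    by (simp add: algebra_simps)
  moreover have "0 \<le> best \<Delta> c D (Suc k)" "best \<Delta> c D k \<le> int k * b"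
    using best_bounds[OF assms(1,2) U(1)] U(2) by auto
  moreover have "int k * b \<le> int m * b"
    using k(2) assms(3) by (intro mult_right_mono) auto
  ultimately show False by simp
qed

section \<open>Transfer to the masked problem\<close>

lemma sum_masked_cost:
  assumes "finite S" "S \<inter> {s..e} = {}"
  shows "(\<Sum>i\<in>S. masked_cost c s e i) = ereal (real_of_int (\<Sum>i\<in>S. int (c i)))"
proof -
  have "(\<Sum>i\<in>S. masked_cost c s e i) = (\<Sum>i\<in>S. ereal (real (c i)))"
    by (rule sum.cong) (use assms(2) in \<open>auto simp: masked_cost_def\<close>)
  then show ?thesis by simp
qed

lemma sum_masked_cost_MInf:
  assumes "finite S" "S \<inter> {s..e} \<noteq> {}"
  shows "(\<Sum>i\<in>S. masked_cost c s e i) = -\<infinity>"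
proof -
  obtain x where x: "x \<in> S" "x \<in> {s..e}" using assms(2) by blast
  have "(\<Sum>i\<in>S. masked_cost c s e i) = masked_cost c s e x + (\<Sum>i\<in>S - {x}. masked_cost c s e i)"
    using assms(1) x(1) by (rule sum.remove)
  moreover have "(\<Sum>i\<in>S - {x}. masked_cost c s e i) \<noteq> \<infinity>"
    by (auto simp: sum_Pinfty masked_cost_def)
  ultimately show ?thesis using x(2) by (simp add: masked_cost_def)
qed

text \<open>Lagrangian argument: with the same \<mu> on both sides the penalised inequalities add
  up, and a competitor of the same total size pays the same total penalty, however it splits between
  the sides.\<close>

lemma optimal_of_penalised_max:
  fixes c :: "nat \<Rightarrow> nat" and \<mu> :: int and \<Delta> d s e m n :: nat
  defines "L \<equiv> {1..<s}" and "R \<equiv> {e<..d}"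
  assumes far: "\<And>i j. i \<in> L \<Longrightarrow> j \<in> R \<Longrightarrow> i + \<Delta> \<le> j" and se: "s \<le> e"
    and L: "penalised_max \<Delta> (\<lambda>i. int (c i)) L \<mu> m" and R: "penalised_max \<Delta> (\<lambda>i. int (c i)) R \<mu> n"
    and "s \<le> d"
  shows "\<exists>S. optimal_separated_solution \<Delta> d (masked_cost c s e) (m + n) S \<and>
    card {i \<in> S. i < s} = m \<and> card {i \<in> S. i > e} = n"
proof -
  let ?c = "\<lambda>i. int (c i)"
  have fin: "finite L" "finite R" and disj: "L \<inter> R = {}"
    using se by (auto simp: L_def R_def)
  obtain A where A: "A \<in> separated_subsets \<Delta> L" "card A = m" "sum ?c A = best \<Delta> ?c L m"
    using L best_attained[OF fin(1)] unfolding penalised_max_def by (metis order_refl)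
  obtain B where B: "B \<in> separated_subsets \<Delta> R" "card B = n" "sum ?c B = best \<Delta> ?c R n"
    using R best_attained[OF fin(2)] unfolding penalised_max_def by (metis order_refl)
  have sub: "A \<subseteq> L" "B \<subseteq> R" and finAB: "finite A" "finite B"
    using A(1) B(1) fin by (auto simp: separated_subsets_def intro: finite_subset)
  have AB: "A \<inter> B = {}" using sub disj by blast
  have sep: "separated \<Delta> (A \<union> B)"
  proof (rule separated_union)
    fix i j assume "i \<in> A" "j \<in> B"
    then have "i \<in> L" "j \<in> R" using sub by auto
    then show "i < j \<and> i + \<Delta> \<le> j" using far[of i j] se by (auto simp: L_def R_def)
  qed (use A(1) B(1) in \<open>auto simp: separated_subsets_def\<close>)
  have sol: "separated_solution \<Delta> d (m + n) (A \<union> B)"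
    using sep sub A(2) B(2) card_Un_disjoint[OF finAB AB] \<open>s \<le> d\<close>
    by (auto simp: separated_solution_iff L_def R_def)
  have "(\<Sum>i\<in>T. masked_cost c s e i) \<le> (\<Sum>i\<in>A \<union> B. masked_cost c s e i)"
    if T: "separated_solution \<Delta> d (m + n) T" for T
  proof (cases "T \<inter> {s..e} = {}")
    case True
    have finT: "finite T" and sepT: "separated \<Delta> T" and cardT: "card T = m + n"
      using T by (auto simp: separated_solution_iff intro: finite_subset)
    have split: "T = (T \<inter> L) \<union> (T \<inter> R)"
    proof -
      have "x \<in> L \<union> R" if "x \<in> T" for x
      proof -
        have "x \<in> {1..d}" "x \<notin> {s..e}"
          using that T True by (auto simp: separated_solution_iff)
        then show ?thesis by (auto simp: L_def R_def)
      qed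
      then show ?thesis by blast
    qed
    have in_sub: "T \<inter> L \<in> separated_subsets \<Delta> L" "T \<inter> R \<in> separated_subsets \<Delta> R"
      using sepT by (auto simp: separated_subsets_def intro: separated_subset)
    have "sum ?c T = sum ?c ((T \<inter> L) \<union> (T \<inter> R))"
      using split by (rule arg_cong)
    also have "\<dots> = sum ?c (T \<inter> L) + sum ?c (T \<inter> R)"
      using finT disj by (intro sum.union_disjoint) auto
    also have "\<dots> \<le> best \<Delta> ?c L (card (T \<inter> L)) + best \<Delta> ?c R (card (T \<inter> R))"
      using in_sub best_ge fin by (intro add_mono) auto
    also have "\<dots> \<le> best \<Delta> ?c L m - \<mu> * int m + \<mu> * int (card (T \<inter> L))
        + (best \<Delta> ?c R n - \<mu> * int n + \<mu> * int (card (T \<inter> R)))"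
    proof -
      have "best \<Delta> ?c L (card (T \<inter> L)) - \<mu> * int (card (T \<inter> L)) \<le> best \<Delta> ?c L m - \<mu> * int m"
        "best \<Delta> ?c R (card (T \<inter> R)) - \<mu> * int (card (T \<inter> R)) \<le> best \<Delta> ?c R n - \<mu> * int n"
        using L R in_sub unfolding penalised_max_def by blast+
      then show ?thesis by linarith
    qed
    also have "\<dots> = best \<Delta> ?c L m + best \<Delta> ?c R n
        + \<mu> * (int (card (T \<inter> L)) + int (card (T \<inter> R)) - (int m + int n))"
      by (simp add: algebra_simps)
    also have "T \<inter> L \<inter> (T \<inter> R) = {}" using disj by blast
    then have "card (T \<inter> L) + card (T \<inter> R) = m + n"
      using card_Un_disjoint[of "T \<inter> L" "T \<inter> R"] finT cardT
      unfolding split[symmetric] by simp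
    \<comment> \<open>This equation enters the calculation by substitution and cancels the penalty
      term.\<close>
    then have "int (card (T \<inter> L)) + int (card (T \<inter> R)) - (int m + int n) = 0"
      by linarith
    also have "best \<Delta> ?c L m + best \<Delta> ?c R n + \<mu> * 0 = sum ?c (A \<union> B)"
      using A(3) B(3) sum.union_disjoint[OF finAB AB, of ?c] by simp
    finally have "sum ?c T \<le> sum ?c (A \<union> B)" .
    moreover have "(A \<union> B) \<inter> {s..e} = {}"
      using sub by (auto simp: L_def R_def)
    ultimately show ?thesis
      using True finT finAB by (simp only: sum_masked_cost finite_UnI ereal_less_eq of_int_le_iff)
  next
    \<comment> \<open>A competitor that meets the masked block has value minus infinity, because no
      other summand is plus infinity.\<close>
    case False
    moreover have "finite T"
      using T by (auto simp: separated_solution_iff intro: finite_subset)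
    ultimately show ?thesis
      by (simp add: sum_masked_cost_MInf)
  qed
  moreover have "{i \<in> A \<union> B. i < s} = A" "{i \<in> A \<union> B. i > e} = B"
    using sub se by (auto simp: L_def R_def)
  ultimately show ?thesis
    using sol A(2) B(2) by (auto simp: optimal_separated_solution_def)
qed

subsection \<open>Weakest preconditions with running time\<close>

text \<open>The postcondition also sees the running time. Existence of a run already includes
  termination and the fact that every number fits into a word.\<close>

definition wp :: "int \<Rightarrow> com \<Rightarrow> (nat \<Rightarrow> state \<Rightarrow> bool) \<Rightarrow> state \<Rightarrow> bool" where
  "wp W P Q \<sigma> \<longleftrightarrow> (\<exists>t \<sigma>'. exec W P \<sigma> t \<sigma>' \<and> Q t \<sigma>')"

lemma wp_Skip: "Q 1 \<sigma> \<Longrightarrow> wp W Skip Q \<sigma>"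
  unfolding wp_def by (blast intro: exec_Skip)

lemma wp_Assign:
  "fits W a (r, m) \<Longrightarrow> Q (1 + cost a) (r(x := val a (r, m)), m) \<Longrightarrow> wp W (Assign x a) Q (r, m)"
  unfolding wp_def using exec_Assign[of W a "(r, m)" x] by auto

lemma wp_Store:
  "fits W a (r, m) \<Longrightarrow> fits W b (r, m) \<Longrightarrow>
    Q (1 + cost a + cost b) (r, m(val a (r, m) := val b (r, m))) \<Longrightarrow> wp W (Store a b) Q (r, m)"
  unfolding wp_def using exec_Store[of W a "(r, m)" b] by auto

lemma wp_Seq: "wp W P (\<lambda>t. wp W P' (\<lambda>u. Q (t + u))) \<sigma> \<Longrightarrow> wp W (Seq P P') Q \<sigma>"
  unfolding wp_def by (blast intro: exec_Seq)

lemma wp_Cond: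
  assumes "bfits W p \<sigma>" "bval p \<sigma> \<Longrightarrow> wp W P (\<lambda>t. Q (1 + bcost p + t)) \<sigma>"
    "\<not> bval p \<sigma> \<Longrightarrow> wp W P' (\<lambda>t. Q (1 + bcost p + t)) \<sigma>"
  shows "wp W (Cond p P P') Q \<sigma>"
  using assms unfolding wp_def by (cases "bval p \<sigma>") (blast intro: exec_CondT exec_CondF)+

lemma wp_mono: "wp W P Q \<sigma> \<Longrightarrow> (\<And>t \<sigma>'. Q t \<sigma>' \<Longrightarrow> Q' t \<sigma>') \<Longrightarrow> wp W P Q' \<sigma>"
  unfolding wp_def by blast

lemma wp_Seq_le:
  assumes "wp W P (\<lambda>t \<sigma>'. t \<le> T \<and> I \<sigma>') \<sigma>"
    "\<And>\<sigma>'. I \<sigma>' \<Longrightarrow> wp W P' (\<lambda>t \<sigma>''. t \<le> U \<and> Q \<sigma>'') \<sigma>'" "T + U \<le> V"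
  shows "wp W (Seq P P') (\<lambda>t \<sigma>''. t \<le> V \<and> Q \<sigma>'') \<sigma>"
proof (rule wp_Seq, rule wp_mono[OF assms(1)])
  fix t \<sigma>' assume "t \<le> T \<and> I \<sigma>'"
  then show "wp W P' (\<lambda>u \<sigma>''. t + u \<le> V \<and> Q \<sigma>'') \<sigma>'"
    using assms(3) by (intro wp_mono[OF assms(2)]) auto
qed

text \<open>The index of the invariant drops by one per iteration, so it is both the termination
  measure and an upper bound on the iterations left. For the binary search it is a bound on the
  logarithm of the interval length.\<close>

lemma wp_While:
  assumes inv: "I n \<sigma>"
    and fit: "\<And>n \<sigma>. I n \<sigma> \<Longrightarrow> bfits W p \<sigma>"
    and step: "\<And>n \<sigma>. I n \<sigma> \<Longrightarrow> bval p \<sigma> \<Longrightarrow>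
      \<exists>m. n = Suc m \<and> wp W P (\<lambda>t \<sigma>'. t \<le> T \<and> I m \<sigma>') \<sigma>"
  shows "wp W (While p P)
    (\<lambda>t \<sigma>'. t \<le> n * (1 + bcost p + T) + (1 + bcost p) \<and> \<not> bval p \<sigma>' \<and> (\<exists>m. I m \<sigma>')) \<sigma>"
  using inv
proof (induction n arbitrary: \<sigma>)
  case 0
  then have "\<not> bval p \<sigma>" using step by blast
  then show ?case
    using exec_WhileF[OF fit[OF 0]] 0 unfolding wp_def by fastforce
next
  case (Suc n)
  show ?case
  proof (cases "bval p \<sigma>")
    case True
    obtain t \<sigma>' where body: "exec W P \<sigma> t \<sigma>'" "t \<le> T" "I n \<sigma>'"
      using step[OF Suc.prems True] unfolding wp_def by auto
    obtain u \<sigma>'' where rest: "exec W (While p P) \<sigma>' u \<sigma>''"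
        "u \<le> n * (1 + bcost p + T) + (1 + bcost p)" "\<not> bval p \<sigma>''" "\<exists>m. I m \<sigma>''"
      using Suc.IH[OF body(3)] unfolding wp_def by blast
    have "1 + bcost p + t + u \<le> Suc n * (1 + bcost p + T) + (1 + bcost p)"
      using body(2) rest(2) by simp
    then show ?thesis
      using exec_WhileT[OF fit[OF Suc.prems] True body(1) rest(1)] rest(3,4) unfolding wp_def by blast
  next
    case False
    then show ?thesis
      using exec_WhileF[OF fit[OF Suc.prems] False] Suc.prems unfolding wp_def by fastforce
  qed
qed

subsection \<open>The program\<close>

text \<open>Registers 0 to 4 hold the input.  The others are 5: largest cost; 6: loop index;
  7 and 8: bounds of the binary search; 9: penalty \<open>\<mu>\<close>; 10: \<open>d + 1\<close>; 11: \<open>d + \<Delta>\<close>; 12: scratch;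
  13: number of coordinates on the left.  The table entry \<open>g \<mu> j\<close> of the dynamic program is stored in
  cell \<open>d + \<Delta> + j\<close>; the cells \<open>d + 1, \<dots>, d + \<Delta>\<close> stay 0 and serve as the entries with index
  at most 0.\<close>

definition dp_body :: com where
  "dp_body =
    Seq (Cond (Conj (Neg (Less (Reg 6) (Reg 3))) (Neg (Less (Reg 4) (Reg 6))))
           (Store (Add (Reg 11) (Reg 6)) (Load (Sub (Add (Reg 11) (Reg 6)) (Num 1))))
           (Seq (Assign 12 (Add (Load (Sub (Add (Reg 11) (Reg 6)) (Reg 0)))
                  (Add (Mul (Reg 10) (Sub (Load (Reg 6)) (Reg 9))) (Num 1))))
                (Cond (Less (Load (Sub (Add (Reg 11) (Reg 6)) (Num 1))) (Reg 12))
                  (Store (Add (Reg 11) (Reg 6)) (Reg 12))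
                  (Store (Add (Reg 11) (Reg 6)) (Load (Sub (Add (Reg 11) (Reg 6)) (Num 1)))))))
        (Assign 6 (Add (Reg 6) (Num 1)))"

definition dp :: com where
  "dp = Seq (Assign 6 (Num 1)) (While (Less (Reg 6) (Reg 10)) dp_body)"

definition max_body :: com where
  "max_body = Seq (Cond (Less (Reg 5) (Load (Reg 6))) (Assign 5 (Load (Reg 6))) Skip)
     (Assign 6 (Add (Reg 6) (Num 1)))"

definition setup_prog :: com where
  "setup_prog = Seq (Assign 10 (Add (Reg 1) (Num 1))) (Seq (Assign 11 (Add (Reg 1) (Reg 0)))
     (Seq (Assign 6 (Num 1)) (Seq (While (Less (Reg 6) (Reg 10)) max_body)
     (Seq (Assign 7 (Sub (Num 0) (Mul (Reg 2) (Reg 5)))) (Assign 8 (Add (Reg 5) (Num 1)))))))"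

definition left_opt :: exp where
  "left_opt = Load (Sub (Add (Reg 11) (Reg 3)) (Num 1))"

definition right_opt :: exp where
  "right_opt = Sub (Load (Add (Reg 11) (Reg 1))) left_opt"

definition remainder :: "exp \<Rightarrow> exp" where
  "remainder a = Sub a (Mul (Reg 10) (Div a (Reg 10)))"

definition search_body :: com where
  "search_body = Seq (Assign 9 (Div (Add (Reg 7) (Reg 8)) (Num 2))) (Seq dp
     (Cond (Less (Add (remainder left_opt) (remainder right_opt)) (Reg 2))
        (Assign 8 (Reg 9)) (Assign 7 (Reg 9))))"

definition search :: com where
  "search = While (Less (Add (Reg 7) (Num 1)) (Reg 8)) search_body"

text \<open>The table of the larger penalty gives a lower bound for the left part, the table of the smaller
  one an upper bound for the right part.\<close>

definition split_budget :: com where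
  "split_budget =
     Seq (Assign 9 (Reg 8)) (Seq dp (Seq (Assign 13 (remainder left_opt))
     (Seq (Assign 9 (Reg 7)) (Seq dp (Seq (Assign 12 (remainder right_opt))
     (Seq (Cond (Less (Reg 13) (Sub (Reg 2) (Reg 12))) (Assign 13 (Sub (Reg 2) (Reg 12))) Skip)
     (Seq (Assign 0 (Reg 13)) (Assign 1 (Sub (Reg 2) (Reg 13))))))))))"

lemma remainder_correct:
  assumes "fits W a \<sigma>" "0 \<le> val a \<sigma>" "0 < val (Reg 10) \<sigma>" "val (Reg 10) \<sigma> \<le> W"
  shows "fits W (remainder a) \<sigma>" "val (remainder a) \<sigma> = val a \<sigma> mod val (Reg 10) \<sigma>"
proof -
  let ?v = "val a \<sigma>" and ?M = "val (Reg 10) \<sigma>"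
  show mod: "val (remainder a) \<sigma> = ?v mod ?M"
    by (simp add: remainder_def minus_mult_div_eq_mod)
  have v: "\<bar>?v\<bar> \<le> W"
    using assms(1) by (cases a) auto
  have nonneg: "0 \<le> ?v div ?M" "0 \<le> ?v mod ?M"
    using assms(2,3) by (simp_all add: pos_imp_zdiv_nonneg_iff)
  \<comment> \<open>Quotient, product and remainder all lie between 0 and \<open>?v\<close>, so the
    word bound on \<open>?v\<close> covers every intermediate value.\<close>
  have "?M * (?v div ?M) + ?v mod ?M = ?v" by simp
  moreover have "0 \<le> ?M * (?v div ?M)"
    using nonneg assms(3) by simp
  moreover have "?v div ?M \<le> ?M * (?v div ?M)"
    using nonneg(1) assms(3) mult_right_mono[of 1 ?M "?v div ?M"] by simp
  ultimately have "\<bar>?v div ?M\<bar> \<le> W" "\<bar>?M * (?v div ?M)\<bar> \<le> W" "\<bar>?v mod ?M\<bar> \<le> W"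
    using nonneg v by linarith+
  then show "fits W (remainder a) \<sigma>"
    using assms mod unfolding remainder_def by simp
qed

section \<open>The table of the dynamic program and the size of its entries\<close>

locale instance_data =
  fixes \<Delta> d k s e :: nat and c :: "nat \<Rightarrow> nat" and cmax :: nat and W N :: int
  assumes \<Delta>: "1 \<le> \<Delta>" and s: "1 \<le> s" and se: "s \<le> e" and ed: "e \<le> d"
    and gap: "e - s + 1 \<ge> \<Delta> \<or> e = d"
    and feasible: "\<exists>S. separated_solution \<Delta> d k S \<and> S \<inter> {s..e} = {}"
    and cmax: "cmax = Max (c ` {1..d})"
    and N: "N = 2 + int \<Delta> + int d + int k + int cmax"
    and W: "N ^ 6 \<le> W"
begin

text \<open>The weights of \<open>card_opt\<close> with modulus \<open>d + 1\<close>, which exceeds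
  the size of every set of indices on either side.\<close>

definition weight :: "int \<Rightarrow> nat \<Rightarrow> int" where
  "weight \<mu> i = int (d + 1) * (int (c i) - \<mu>) + 1"

definition g :: "int \<Rightarrow> nat \<Rightarrow> int" where
  "g \<mu> n = opt \<Delta> (weight \<mu>) ({1..n} - {s..e})"

lemma c_le: "1 \<le> i \<Longrightarrow> i \<le> d \<Longrightarrow> c i \<le> cmax"
  by (simp add: cmax)

lemma g_0: "g \<mu> 0 = 0"
  by (simp add: g_def opt_empty)

lemma g_Suc_masked: "Suc n \<in> {s..e} \<Longrightarrow> g \<mu> (Suc n) = g \<mu> n"
  by (simp add: g_def atLeastAtMostSuc_conv insert_Diff_if)

lemma g_Suc:
  assumes "Suc n \<notin> {s..e}"
  shows "g \<mu> (Suc n) = max (g \<mu> n) (g \<mu> (Suc n - \<Delta>) + weight \<mu> (Suc n))"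
proof -
  have "{1..Suc n} - {s..e} = insert (Suc n) ({1..n} - {s..e})"
    using assms by auto
  moreover have "{i \<in> {1..n} - {s..e}. i + \<Delta> \<le> Suc n} = {1..Suc n - \<Delta>} - {s..e}"
    using \<Delta> by auto
  ultimately show ?thesis
    unfolding g_def using opt_insert_last[of "{1..n} - {s..e}" "Suc n" \<Delta> "weight \<mu>"] by auto
qed

lemma N_ge: "4 \<le> N"
  using \<Delta> s se ed by (simp add: N)

lemma weight_le:
  assumes "\<bar>\<mu>\<bar> \<le> N ^ 2" "1 \<le> i" "i \<le> d"
  shows "\<bar>int (c i) - \<mu>\<bar> \<le> N + N ^ 2" "\<bar>int (d + 1) * (int (c i) - \<mu>)\<bar> \<le> N ^ 2 + N ^ 3"
    "\<bar>weight \<mu> i\<bar> \<le> N ^ 4"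
proof -
  show 1: "\<bar>int (c i) - \<mu>\<bar> \<le> N + N ^ 2"
    using c_le[OF assms(2,3)] assms(1) N by linarith
  have "\<bar>int (d + 1)\<bar> * \<bar>int (c i) - \<mu>\<bar> \<le> N * (N + N ^ 2)"
    by (rule mult_mono) (use 1 N in auto)
  then show 2: "\<bar>int (d + 1) * (int (c i) - \<mu>)\<bar> \<le> N ^ 2 + N ^ 3"
    unfolding abs_mult by (simp add: distrib_left power2_eq_square power3_eq_cube)
  have "N ^ 2 + N ^ 3 + 1 \<le> N ^ 4"
  proof -
    have "4 * N ^ 3 \<le> N ^ 4" "4 * N ^ 2 \<le> N ^ 3" "1 \<le> N ^ 2"
      using N_ge by (simp_all add: power_eq_if[of _ 4] power_eq_if[of _ 3])
    then show ?thesis by linarith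
  qed
  then show "\<bar>weight \<mu> i\<bar> \<le> N ^ 4"
    using 2 unfolding weight_def by linarith
qed

lemma g_bounds:
  assumes "\<bar>\<mu>\<bar> \<le> N ^ 2" "n \<le> d"
  shows "0 \<le> g \<mu> n" "g \<mu> n \<le> N ^ 5"
proof -
  show "0 \<le> g \<mu> n" by (simp add: g_def opt_nonneg)
  have "g \<mu> n \<le> int (card ({1..n} - {s..e})) * N ^ 4"
    unfolding g_def using weight_le(3)[OF assms(1)] assms(2) N_ge by (intro opt_le) force+
  also have "\<dots> \<le> N * N ^ 4"
    using card_mono[of "{1..n}" "{1..n} - {s..e}"] assms(2) N N_ge by (intro mult_right_mono) auto
  finally show "g \<mu> n \<le> N ^ 5" by (simp add: power_eq_if)
qed

subsection \<open>Correctness of the program\<close>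

definition mem_ok :: "(int \<Rightarrow> int) \<Rightarrow> bool" where
  "mem_ok m \<longleftrightarrow> (\<forall>i. 1 \<le> i \<and> i \<le> d \<longrightarrow> m (int i) = int (c i)) \<and>
     (\<forall>a. int d < a \<and> a \<le> int (d + \<Delta>) \<longrightarrow> m a = 0)"

definition regs_ok :: "(nat \<Rightarrow> int) \<Rightarrow> bool" where
  "regs_ok r \<longleftrightarrow> r 0 = int \<Delta> \<and> r 1 = int d \<and> r 2 = int k \<and> r 3 = int s \<and> r 4 = int e \<and>
     r 10 = int (d + 1) \<and> r 11 = int (d + \<Delta>)"

text \<open>Origin of the exponent 6: penalties have absolute value at most \<open>N ^ 2\<close>;
  one factor \<open>N\<close> comes from the modulus, one absorbs lower-order terms, one counts the
  summands of a table entry, and the last absorbs the addition of a weight to an entry. As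
  \<open>N\<close> is at least 4, each power is at least four times the previous one.\<close>

lemma word_bounds:
  "N \<le> W" "N ^ 2 \<le> W" "N + N ^ 2 \<le> W" "N ^ 2 + N ^ 3 \<le> W" "N ^ 4 \<le> W" "N ^ 5 \<le> W"
  "N ^ 5 + N ^ 4 \<le> W" "2 * N \<le> W" "2 * N ^ 2 + 1 \<le> W" "4 \<le> W"
proof -
  have "4 * N ^ 5 \<le> N ^ 6" "4 * N ^ 4 \<le> N ^ 5" "4 * N ^ 3 \<le> N ^ 4" "4 * N ^ 2 \<le> N ^ 3" "4 * N \<le> N ^ 2"
    using N_ge by (simp_all add: power_eq_if[of _ 6] power_eq_if[of _ 5] power_eq_if[of _ 4]
        power_eq_if[of _ 3] power2_eq_square)
  then show "N \<le> W" "N ^ 2 \<le> W" "N + N ^ 2 \<le> W" "N ^ 2 + N ^ 3 \<le> W" "N ^ 4 \<le> W" "N ^ 5 \<le> W"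
    "N ^ 5 + N ^ 4 \<le> W" "2 * N \<le> W" "2 * N ^ 2 + 1 \<le> W" "4 \<le> W"
    using N_ge W by linarith+
qed

text \<open>\<open>n\<close> counts the iterations left. Cells beyond the filled part are
  unconstrained, so a pass can overwrite the table of another penalty without clearing it.\<close>

definition dp_inv :: "int \<Rightarrow> (nat \<Rightarrow> int) \<Rightarrow> nat \<Rightarrow> state \<Rightarrow> bool" where
  "dp_inv \<mu> r0 n \<sigma> \<longleftrightarrow> (case \<sigma> of (r, m) \<Rightarrow>
     (\<forall>x. x \<noteq> 6 \<and> x \<noteq> 12 \<longrightarrow> r x = r0 x) \<and> mem_ok m \<and> n \<le> d \<and> r 6 = int (d + 1 - n) \<and>
     (\<forall>j \<le> d - n. m (int (d + \<Delta> + j)) = g \<mu> j))"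


lemma dp_body_wp:
  assumes r0: "regs_ok r0" "r0 9 = \<mu>" and \<mu>: "\<bar>\<mu>\<bar> \<le> N ^ 2"
    and inv: "dp_inv \<mu> r0 (Suc n) \<sigma>"
  shows "wp W dp_body (\<lambda>t \<sigma>'. t \<le> 100 \<and> dp_inv \<mu> r0 n \<sigma>') \<sigma>"
proof -
  obtain r m where \<sigma>: "\<sigma> = (r, m)" by force
  define j where "j = d - Suc n"
  have r: "r x = r0 x" if "x \<noteq> 6" "x \<noteq> 12" for x
    using inv that by (auto simp: dp_inv_def \<sigma>)
  have j: "Suc j \<le> d" "n = d - Suc j" "r 6 = int j + 1"
    and m: "mem_ok m" "\<And>i. i \<le> j \<Longrightarrow> m (int (d + \<Delta> + i)) = g \<mu> i"
    using inv by (auto simp: dp_inv_def \<sigma> j_def)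
  have regs: "r 0 = int \<Delta>" "r 3 = int s" "r 4 = int e" "r 9 = \<mu>" "r 10 = int (d + 1)" "r 11 = int (d + \<Delta>)"
    using r0 r by (auto simp: regs_ok_def)
  have load: "m (r 11 + r 6 - 1) = g \<mu> j" "m (r 6) = int (c (Suc j))"
    using m(2)[of j] m(1) j by (auto simp: regs mem_ok_def algebra_simps dest: spec[of _ "Suc j"])
  \<comment> \<open>For \<open>Suc j\<close> at most \<Delta> the address falls into the zero cells,
    while truncated subtraction turns the index of \<open>g\<close> into 0; the two agree by
    \<open>g_0\<close>.\<close>
  have load': "m (r 11 + r 6 - r 0) = g \<mu> (Suc j - \<Delta>)"
  proof (cases "Suc j \<le> \<Delta>")
    case True
    then show ?thesis using m(1) j by (simp add: regs mem_ok_def g_0)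
  next
    case False
    have "r 11 + r 6 - r 0 = int (d + \<Delta> + (Suc j - \<Delta>))"
      using False by (simp add: regs j of_nat_diff)
    then show ?thesis using m(2)[of "Suc j - \<Delta>"] \<Delta> by simp
  qed
  have weight: "r 10 * (m (r 6) - r 9) + 1 = weight \<mu> (Suc j)"
    by (simp add: load regs weight_def)
  have post: "dp_inv \<mu> r0 n (r', m(r 11 + r 6 := v))"
    if "\<And>x. x \<noteq> 6 \<Longrightarrow> x \<noteq> 12 \<Longrightarrow> r' x = r x" "r' 6 = r 6 + 1" "v = g \<mu> (Suc j)" for r' v
  proof -
    define m' where "m' = m(int (d + \<Delta> + Suc j) := g \<mu> (Suc j))"
    have upd: "m(r 11 + r 6 := v) = m'"
      by (simp add: regs j m'_def add_ac that(3))
    have m': "mem_ok m'"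
      using m(1) by (auto simp: mem_ok_def m'_def)
    have "m' (int (d + \<Delta> + i)) = g \<mu> i" if "i \<le> Suc j" for i
      using that m(2)[of i] by (cases "i = Suc j") (auto simp: m'_def)
    moreover have "d + 1 - n = j + 2" "d - n = Suc j" "n \<le> d" using j by auto
    ultimately show ?thesis
      using that(1,2) r j m' unfolding upd dp_inv_def by simp
  qed
  have bounds: "\<bar>r 0\<bar> \<le> W" "\<bar>r 3\<bar> \<le> W" "\<bar>r 4\<bar> \<le> W" "\<bar>r 9\<bar> \<le> W" "\<bar>r 10\<bar> \<le> W" "\<bar>r 11\<bar> \<le> W"
    "\<bar>r 6\<bar> \<le> W" "1 \<le> W" "\<bar>r 11 + r 6\<bar> \<le> W" "\<bar>r 11 + r 6 - 1\<bar> \<le> W" "\<bar>r 11 + r 6 - r 0\<bar> \<le> W"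
    "\<bar>r 6 + 1\<bar> \<le> W"
    using word_bounds \<mu> N s se ed j(1) unfolding regs j(3) by linarith+
  have gj: "\<bar>g \<mu> j\<bar> \<le> N ^ 5" "\<bar>g \<mu> (Suc j - \<Delta>)\<bar> \<le> N ^ 5"
    using g_bounds[OF \<mu>, of j] g_bounds[OF \<mu>, of "Suc j - \<Delta>"] j(1) by auto
  have wj: "\<bar>int (c (Suc j)) - \<mu>\<bar> \<le> N + N ^ 2"
    "\<bar>int (d + 1) * (int (c (Suc j)) - \<mu>)\<bar> \<le> N ^ 2 + N ^ 3" "\<bar>weight \<mu> (Suc j)\<bar> \<le> N ^ 4"
    using weight_le[OF \<mu>, of "Suc j"] j(1) by auto
  have bounds': "\<bar>m (r 11 + r 6 - 1)\<bar> \<le> W" "\<bar>m (r 11 + r 6 - r 0)\<bar> \<le> W" "\<bar>m (r 6)\<bar> \<le> W"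
    "\<bar>m (r 6) - r 9\<bar> \<le> W" "\<bar>r 10 * (m (r 6) - r 9)\<bar> \<le> W" "\<bar>r 10 * (m (r 6) - r 9) + 1\<bar> \<le> W"
    "\<bar>m (r 11 + r 6 - r 0) + (r 10 * (m (r 6) - r 9) + 1)\<bar> \<le> W"
    using gj wj word_bounds c_le[of "Suc j"] j(1) N
    unfolding weight unfolding load load' unfolding regs(4,5) by linarith+
  show ?thesis
  proof (cases "Suc j \<in> {s..e}")
    case True
    have "g \<mu> (Suc j) = m (r 11 + r 6 - 1)"
      using g_Suc_masked[OF True] load by simp
    moreover have "\<not> r 6 < r 3" "\<not> r 4 < r 6"
      using True by (auto simp: regs j)
    ultimately show ?thesis
      unfolding \<sigma> dp_body_def
      by (intro wp_Seq wp_Cond wp_Assign wp_Store; simp add: bounds bounds' post)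
  next
    case False
    let ?v = "m (r 11 + r 6 - r 0) + (r 10 * (m (r 6) - r 9) + 1)"
    have "g \<mu> (Suc j) = (if m (r 11 + r 6 - 1) < ?v then ?v else m (r 11 + r 6 - 1))"
      using g_Suc[OF False] load load' weight by auto
    moreover have "r 6 < r 3 \<or> r 4 < r 6"
      using False by (auto simp: regs j)
    ultimately show ?thesis
      unfolding \<sigma> dp_body_def
      by (intro wp_Seq wp_Cond wp_Assign wp_Store; simp add: bounds bounds' post)
  qed
qed

definition dp_post :: "int \<Rightarrow> (nat \<Rightarrow> int) \<Rightarrow> state \<Rightarrow> bool" where
  "dp_post \<mu> r \<sigma> \<longleftrightarrow> (\<forall>x. x \<noteq> 6 \<and> x \<noteq> 12 \<longrightarrow> fst \<sigma> x = r x) \<and> mem_ok (snd \<sigma>) \<and>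
     (\<forall>j \<le> d. snd \<sigma> (int (d + \<Delta> + j)) = g \<mu> j)"

lemma dp_wp:
  assumes r: "regs_ok r" "r 9 = \<mu>" and \<mu>: "\<bar>\<mu>\<bar> \<le> N ^ 2" and m: "mem_ok m"
  shows "wp W dp (\<lambda>t \<sigma>. t \<le> 200 * d \<and> dp_post \<mu> r \<sigma>) (r, m)"
proof -
  let ?p = "Less (Reg 6) (Reg 10)"
  have init: "dp_inv \<mu> r d (r(6 := 1), m)"
  proof -
    have "m (int (d + \<Delta>)) = 0"
      using m \<Delta> by (simp add: mem_ok_def)
    then show ?thesis
      using m unfolding dp_inv_def by (simp add: g_0)
  qed
  have fit: "bfits W ?p \<sigma>" if "dp_inv \<mu> r n \<sigma>" for n \<sigma>
    using that r(1) word_bounds N by (auto simp: dp_inv_def regs_ok_def)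
  have "\<exists>m. n = Suc m \<and> wp W dp_body (\<lambda>t \<sigma>'. t \<le> 100 \<and> dp_inv \<mu> r m \<sigma>') \<sigma>"
    if "dp_inv \<mu> r n \<sigma>" "bval ?p \<sigma>" for n \<sigma>
  proof (cases n)
    case 0
    then show ?thesis using that r(1) by (auto simp: dp_inv_def regs_ok_def)
  next
    case (Suc m)
    then show ?thesis using dp_body_wp[OF r \<mu>] that by blast
  qed
  note loop = wp_While[where I = "dp_inv \<mu> r", OF init fit this]
  show ?thesis
    unfolding dp_def
  proof (rule wp_Seq_le)
    show "wp W (Assign 6 (Num 1)) (\<lambda>t \<sigma>. t \<le> 2 \<and> \<sigma> = (r(6 := 1), m)) (r, m)"
      by (rule wp_Assign) (use word_bounds in auto)
    \<comment> \<open>Each iteration takes at most 104 units including its test, and the final test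
      takes 4, which \<open>d >= 1\<close> absorbs.\<close>
    show "wp W (While ?p dp_body) (\<lambda>t \<sigma>'. t \<le> 108 * d \<and> dp_post \<mu> r \<sigma>') \<sigma>"
      if "\<sigma> = (r(6 := 1), m)" for \<sigma>
      unfolding that
    proof (rule wp_mono[OF loop])
      fix t \<sigma>'
      assume *: "t \<le> d * (1 + bcost ?p + 100) + (1 + bcost ?p) \<and> \<not> bval ?p \<sigma>' \<and> (\<exists>n. dp_inv \<mu> r n \<sigma>')"
      obtain r' m' where \<sigma>': "\<sigma>' = (r', m')" by force
      obtain n where inv: "dp_inv \<mu> r n (r', m')" using * \<sigma>' by blast
      have "n = 0"
        using inv * r(1) by (auto simp: \<sigma>' dp_inv_def regs_ok_def)
      then have "dp_post \<mu> r \<sigma>'"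
        using inv by (simp add: \<sigma>' dp_inv_def dp_post_def)
      then show "t \<le> 108 * d \<and> dp_post \<mu> r \<sigma>'"
        using * s se ed by auto
    qed
    show "2 + 108 * d \<le> 200 * d" using s se ed by simp
  qed
qed

section \<open>Reading off the sizes on the two sides\<close>

abbreviation L :: "nat set" where "L \<equiv> {1..<s}"
abbreviation R :: "nat set" where "R \<equiv> {e<..d}"
abbreviation ci :: "nat \<Rightarrow> int" where "ci \<equiv> \<lambda>i. int (c i)"

definition cntL :: "int \<Rightarrow> nat" where "cntL \<mu> = nat (g \<mu> (s - 1) mod int (d + 1))"
definition cntR :: "int \<Rightarrow> nat" where "cntR \<mu> = nat ((g \<mu> d - g \<mu> (s - 1)) mod int (d + 1))"

text \<open>Here the hypothesis on the block enters: either the block spans at least \<Delta>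
  indices, or \<open>e = d\<close> and \<open>R\<close> is empty.\<close>

lemma far: "i \<in> L \<Longrightarrow> j \<in> R \<Longrightarrow> i + \<Delta> \<le> j"
  using gap se by auto

lemma g_left: "g \<mu> (s - 1) = opt \<Delta> (weight \<mu>) L"
proof -
  have "{1..s - 1} - {s..e} = L" using s by auto
  then show ?thesis by (simp only: g_def)
qed

lemma g_right: "g \<mu> d - g \<mu> (s - 1) = opt \<Delta> (weight \<mu>) R"
proof -
  have "{1..d} - {s..e} = L \<union> R" using se ed by auto
  moreover have "opt \<Delta> (weight \<mu>) (L \<union> R) = opt \<Delta> (weight \<mu>) L + opt \<Delta> (weight \<mu>) R"
    using far se by (intro opt_union) force+
  ultimately show ?thesis unfolding g_left by (simp add: g_def)
qed

lemma cntL: "largest_penalised_max \<Delta> ci L \<mu> (cntL \<mu>)"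
  using card_opt[of L "d + 1" \<Delta> ci \<mu>] se ed unfolding cntL_def g_left weight_def by simp

lemma cntR: "largest_penalised_max \<Delta> ci R \<mu> (cntR \<mu>)"
  using card_opt[of R "d + 1" \<Delta> ci \<mu>] se ed unfolding cntR_def g_right weight_def by simp

lemma cost_bounds:
  "i \<in> L \<Longrightarrow> 0 \<le> ci i \<and> ci i \<le> int cmax" "i \<in> R \<Longrightarrow> 0 \<le> ci i \<and> ci i \<le> int cmax"
  using c_le[of i] s se ed by auto

lemma cnt_high: "cntL (int cmax + 1) + cntR (int cmax + 1) \<le> k"
  using largest_penalised_max_high_penalty[OF _ cost_bounds(1) cntL]
    largest_penalised_max_high_penalty[OF _ cost_bounds(2) cntR] by simp

text \<open>If the total were below \<open>k\<close>, each count would be below \<open>k\<close> and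
  thus, by \<open>largest_penalised_max_low_penalty\<close>, the largest size possible on its side.
  A feasible solution shows that these largest sizes add up to at least \<open>k\<close>.\<close>

lemma cnt_low: "k \<le> cntL (- int k * int cmax) + cntR (- int k * int cmax)" (is "_ \<le> ?l + ?r")
proof (rule ccontr)
  assume less: "\<not> k \<le> ?l + ?r"
  obtain S where S: "separated_solution \<Delta> d k S" "S \<inter> {s..e} = {}" using feasible by blast
  have in_sub: "S \<inter> L \<in> separated_subsets \<Delta> L" "S \<inter> R \<in> separated_subsets \<Delta> R"
    using S(1) by (auto simp: separated_solution_iff separated_subsets_def intro: separated_subset)
  have "x \<in> (S \<inter> L) \<union> (S \<inter> R)" if "x \<in> S" for x
  proof -
    have "x \<in> {1..d}" "x \<notin> {s..e}"
      using that S by (auto simp: separated_solution_iff)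
    then show ?thesis using that by auto
  qed
  then have "S \<subseteq> (S \<inter> L) \<union> (S \<inter> R)" by blast
  then have "card S \<le> card ((S \<inter> L) \<union> (S \<inter> R))"
    by (rule card_mono[rotated]) simp
  also have "\<dots> \<le> card (S \<inter> L) + card (S \<inter> R)" by (rule card_Un_le)
  also have "card (S \<inter> L) \<le> ?l"
    using largest_penalised_max_low_penalty[OF _ cost_bounds(1) _ cntL _ in_sub(1)] less by auto
  also have "card (S \<inter> R) \<le> ?r"
    using largest_penalised_max_low_penalty[OF _ cost_bounds(2) _ cntR _ in_sub(2)] less by auto
  finally show False using less S(1) by (simp add: separated_solution_iff)
qed

text \<open>\<open>kL\<close> is the least admissible size on the left: at least the left size for
  \<open>\<mu> + 1\<close>, and large enough that the right side receives at most its size for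
  \<mu>. The bounds on the total of both sizes give the two remaining inequalities.\<close>

lemma split_optimal:
  assumes "k \<le> cntL \<mu> + cntR \<mu>" "cntL (\<mu> + 1) + cntR (\<mu> + 1) \<le> k"
  defines "kL \<equiv> max (cntL (\<mu> + 1)) (k - cntR \<mu>)"
  shows "kL \<le> k" "\<exists>S. optimal_separated_solution \<Delta> d (masked_cost c s e) k S \<and>
    card {i \<in> S. i < s} = kL \<and> card {i \<in> S. i > e} = k - kL"
proof -
  have mono: "cntL (\<mu> + 1) \<le> cntL \<mu>" "cntR (\<mu> + 1) \<le> cntR \<mu>"
    using largest_penalised_max_antimono cntL cntR by blast+
  show kL: "kL \<le> k" using assms by auto
  have "penalised_max \<Delta> ci L \<mu> kL"
    by (rule penalised_max_between[OF \<Delta> _ cntL cntL]) (use assms mono in auto)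
  moreover have "penalised_max \<Delta> ci R \<mu> (k - kL)"
    by (rule penalised_max_between[OF \<Delta> _ cntR cntR]) (use assms mono in auto)
  ultimately show "\<exists>S. optimal_separated_solution \<Delta> d (masked_cost c s e) k S \<and>
    card {i \<in> S. i < s} = kL \<and> card {i \<in> S. i > e} = k - kL"
    using optimal_of_penalised_max[of s e d \<Delta> c \<mu> kL "k - kL"] far se ed kL by auto
qed

lemma after_dp:
  assumes r: "regs_ok r" and \<mu>: "\<bar>\<mu>\<bar> \<le> N ^ 2" and m: "\<forall>j \<le> d. m (int (d + \<Delta> + j)) = g \<mu> j"
  shows "fits W (remainder left_opt) (r, m)" "val (remainder left_opt) (r, m) = int (cntL \<mu>)"
    "fits W (remainder right_opt) (r, m)" "val (remainder right_opt) (r, m) = int (cntR \<mu>)"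
    "int (cntL \<mu>) \<le> int d" "int (cntR \<mu>) \<le> int d"
proof -
  have regs: "r 1 = int d" "r 3 = int s" "r 10 = int (d + 1)" "r 11 = int (d + \<Delta>)"
    using r by (auto simp: regs_ok_def)
  have addr: "r 11 + r 3 - 1 = int (d + \<Delta> + (s - 1))" "r 11 + r 1 = int (d + \<Delta> + d)"
    unfolding regs using s by (simp_all add: of_nat_diff)
  have load: "m (r 11 + r 3 - 1) = g \<mu> (s - 1)" "m (r 11 + r 1) = g \<mu> d"
    unfolding addr using m se ed by auto
  have "0 \<le> opt \<Delta> (weight \<mu>) L" "0 \<le> opt \<Delta> (weight \<mu>) R"
    by (simp_all only: opt_nonneg finite_atLeastLessThan finite_greaterThanAtMost)
  then have nonneg: "0 \<le> g \<mu> (s - 1)" "0 \<le> g \<mu> d - g \<mu> (s - 1)"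
    using g_right[of \<mu>] g_left[of \<mu>] by linarith+
  have bound: "g \<mu> d \<le> W" using g_bounds[OF \<mu>, of d] word_bounds by simp
  have vals: "val left_opt (r, m) = g \<mu> (s - 1)" "val right_opt (r, m) = g \<mu> d - g \<mu> (s - 1)"
    by (simp_all add: left_opt_def right_opt_def load del: One_nat_def)
  have fits_regs: "\<bar>r 1\<bar> \<le> W" "\<bar>r 3\<bar> \<le> W" "\<bar>r 11\<bar> \<le> W" "1 \<le> W" "\<bar>r 11 + r 3\<bar> \<le> W"
    "\<bar>r 11 + r 3 - 1\<bar> \<le> W" "\<bar>r 11 + r 1\<bar> \<le> W"
    using word_bounds N s se ed unfolding regs by linarith+
  have fits: "fits W left_opt (r, m)" "fits W right_opt (r, m)"
    using fits_regs nonneg bound by (simp_all add: left_opt_def right_opt_def load del: One_nat_def)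
  have M: "0 < val (Reg 10) (r, m)" "val (Reg 10) (r, m) \<le> W"
    using word_bounds N by (simp_all add: regs)
  show "fits W (remainder left_opt) (r, m)" "fits W (remainder right_opt) (r, m)"
    using remainder_correct(1)[OF fits(1) _ M] remainder_correct(1)[OF fits(2) _ M] nonneg vals by auto
  show "val (remainder left_opt) (r, m) = int (cntL \<mu>)" "val (remainder right_opt) (r, m) = int (cntR \<mu>)"
    using remainder_correct(2)[OF fits(1) _ M] remainder_correct(2)[OF fits(2) _ M] nonneg vals
    by (simp_all add: cntL_def cntR_def regs)
  show "int (cntL \<mu>) \<le> int d" "int (cntR \<mu>) \<le> int d"
  proof -
    have "x mod int (d + 1) \<le> int d" for x
      using pos_mod_bound[of "int (d + 1)" x] by linarith
    then show "int (cntL \<mu>) \<le> int d" "int (cntR \<mu>) \<le> int d"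
      unfolding cntL_def cntR_def by (simp_all only: int_nat_eq) simp_all
  qed
qed

lemma remainder_cost: "cost (remainder left_opt) = 17" "cost (remainder right_opt) = 27"
  by (simp_all add: remainder_def left_opt_def right_opt_def)

section \<open>The largest cost\<close>

definition max_inv :: "(nat \<Rightarrow> int) \<Rightarrow> (int \<Rightarrow> int) \<Rightarrow> nat \<Rightarrow> state \<Rightarrow> bool" where
  "max_inv r0 m n \<sigma> \<longleftrightarrow> snd \<sigma> = m \<and> (\<forall>x. x \<noteq> 5 \<and> x \<noteq> 6 \<longrightarrow> fst \<sigma> x = r0 x) \<and> n \<le> d \<and>
     fst \<sigma> 6 = int (d + 1 - n) \<and> fst \<sigma> 5 = int (Max (insert 0 (c ` {1..d - n})))"

lemma max_body_wp:
  assumes m: "mem_ok m" and inv: "max_inv r0 m (Suc n) \<sigma>"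
  shows "wp W max_body (\<lambda>t \<sigma>'. t \<le> 20 \<and> max_inv r0 m n \<sigma>') \<sigma>"
proof -
  obtain r where \<sigma>: "\<sigma> = (r, m)" using inv by (cases \<sigma>) (auto simp: max_inv_def)
  define j where "j = d - Suc n"
  define M where "M = Max (insert 0 (c ` {1..j}))"
  have j: "Suc j \<le> d" "n = d - Suc j" "r 6 = int j + 1" "r 5 = int M"
    and r: "\<And>x. x \<noteq> 5 \<Longrightarrow> x \<noteq> 6 \<Longrightarrow> r x = r0 x"
    using inv by (auto simp: max_inv_def \<sigma> j_def M_def)
  have load: "m (r 6) = int (c (Suc j))"
    using m j by (auto simp: mem_ok_def algebra_simps dest: spec[of _ "Suc j"])
  have M': "Max (insert 0 (c ` {1..Suc j})) = max (c (Suc j)) M"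
  proof -
    have "insert 0 (c ` {1..Suc j}) = insert (c (Suc j)) (insert 0 (c ` {1..j}))"
      by (auto simp: atLeastAtMostSuc_conv)
    moreover have "Max (insert (c (Suc j)) (insert 0 (c ` {1..j}))) = max (c (Suc j)) M"
      unfolding M_def by (rule Max_insert) auto
    ultimately show ?thesis by (simp only:)
  qed
  have post: "max_inv r0 m n (r', m)"
    if "\<And>x. x \<noteq> 5 \<Longrightarrow> x \<noteq> 6 \<Longrightarrow> r' x = r x" "r' 6 = r 6 + 1" "r' 5 = max (m (r 6)) (r 5)" for r'
  proof -
    have "d + 1 - n = j + 2" "d - n = Suc j" "n \<le> d" using j by auto
    moreover have "r' 5 = int (Max (insert 0 (c ` {1..Suc j})))"
      unfolding M' that(3) load j(4) by simp
    ultimately show ?thesis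
      using that(1,2) r j(3) unfolding max_inv_def by simp
  qed
  have "M \<le> cmax"
    unfolding M_def using c_le j(1) by (intro Max.boundedI) auto
  moreover have "c (Suc j) \<le> cmax" using c_le j(1) by simp
  ultimately have bounds: "\<bar>r 5\<bar> \<le> W" "\<bar>m (r 6)\<bar> \<le> W" "\<bar>r 6\<bar> \<le> W" "\<bar>r 6 + 1\<bar> \<le> W" "1 \<le> W"
    using word_bounds N j(1) unfolding load unfolding j(3,4) by linarith+
  show ?thesis
    unfolding \<sigma> max_body_def
    by (intro wp_Seq wp_Cond wp_Assign wp_Skip; simp add: bounds post)
qed

section \<open>Binary search for the penalty\<close>

definition search_inv :: "nat \<Rightarrow> state \<Rightarrow> bool" where
  "search_inv n \<sigma> \<longleftrightarrow> (case \<sigma> of (r, m) \<Rightarrow> regs_ok r \<and> mem_ok m \<and>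
     r 7 < r 8 \<and> r 8 - r 7 \<le> 2 ^ n \<and> - int k * int cmax \<le> r 7 \<and> r 8 \<le> int cmax + 1 \<and>
     k \<le> cntL (r 7) + cntR (r 7) \<and> cntL (r 8) + cntR (r 8) \<le> k)"

lemma penalty_bound:
  assumes "- int k * int cmax \<le> \<mu>" "\<mu> \<le> int cmax + 1"
  shows "\<bar>\<mu>\<bar> \<le> N ^ 2"
proof -
  have "int k * int cmax \<le> N * N" by (rule mult_mono) (auto simp: N)
  moreover have "N \<le> N * N" using N_ge by simp
  ultimately show ?thesis using assms N unfolding power2_eq_square by linarith
qed

lemma regs_ok_cong:
  assumes "regs_ok r" "\<And>x. x \<le> 4 \<or> x = 10 \<or> x = 11 \<Longrightarrow> r' x = r x"
  shows "regs_ok r'"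
  using assms by (simp add: regs_ok_def)

lemma regs_ok_upd: "4 < x \<Longrightarrow> x \<noteq> 10 \<Longrightarrow> x \<noteq> 11 \<Longrightarrow> regs_ok (r(x := v)) \<longleftrightarrow> regs_ok r"
  by (simp add: regs_ok_def)

lemma setup_wp:
  assumes n: "(k + 1) * cmax + 1 \<le> 2 ^ n"
  shows "wp W setup_prog (\<lambda>t \<sigma>. t \<le> 100 * d \<and> search_inv n \<sigma>) (input_state \<Delta> d k s e c)"
proof -
  obtain r m where input: "input_state \<Delta> d k s e c = (r, m)" by force
  let ?p = "Less (Reg 6) (Reg 10)"
  let ?r = "r(10 := int (d + 1), 11 := int (d + \<Delta>))"
  have m: "mem_ok m" and r: "regs_ok ?r" and r0: "r 0 = int \<Delta>" "r 1 = int d" "r 5 = 0"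
    using input by (auto simp: input_state_def mem_ok_def regs_ok_def)
  have init: "max_inv ?r m d (?r(6 := 1), m)"
    using r0 by (simp add: max_inv_def)
  have fit: "bfits W ?p \<sigma>" if "max_inv ?r m n \<sigma>" for n \<sigma>
    using that word_bounds N by (auto simp: max_inv_def)
  have body: "\<exists>n'. n = Suc n' \<and> wp W max_body (\<lambda>t \<sigma>'. t \<le> 20 \<and> max_inv ?r m n' \<sigma>') \<sigma>"
    if "max_inv ?r m n \<sigma>" "bval ?p \<sigma>" for n \<sigma>
  proof (cases n)
    case 0
    then show ?thesis using that by (auto simp: max_inv_def)
  next
    case (Suc n')
    then show ?thesis using max_body_wp[OF m] that by blast
  qed
  note loop = wp_While[where I = "max_inv ?r m", OF init fit body]
  have loop: "wp W (While ?p max_body)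
      (\<lambda>t \<sigma>. t \<le> 28 * d \<and> snd \<sigma> = m \<and> regs_ok (fst \<sigma>) \<and> fst \<sigma> 5 = int cmax) (?r(6 := 1), m)"
  proof (rule wp_mono[OF loop])
    fix t \<sigma>
    assume *: "t \<le> d * (1 + bcost ?p + 20) + (1 + bcost ?p) \<and> \<not> bval ?p \<sigma> \<and> (\<exists>n. max_inv ?r m n \<sigma>)"
    then obtain n where inv: "max_inv ?r m n \<sigma>" by blast
    have "n = 0"
      using inv * by (auto simp: max_inv_def)
    \<comment> \<open>The inserted 0 gives the empty prefix a maximum, namely the initial content of
      register 5. Since \<open>d >= 1\<close> and costs are natural numbers, it does not change the
      final maximum.\<close>
    moreover have "Max (insert 0 (c ` {1..d})) = cmax"
      using s se ed by (subst Max_insert) (auto simp: cmax)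
    moreover have "regs_ok (fst \<sigma>)"
      using inv by (intro regs_ok_cong[OF r]) (auto simp: max_inv_def)
    ultimately show "t \<le> 28 * d \<and> snd \<sigma> = m \<and> regs_ok (fst \<sigma>) \<and> fst \<sigma> 5 = int cmax"
      using * inv s se ed by (auto simp: max_inv_def)
  qed
  have range: "wp W (Seq (Assign 7 (Sub (Num 0) (Mul (Reg 2) (Reg 5)))) (Assign 8 (Add (Reg 5) (Num 1))))
      (\<lambda>t \<sigma>. t \<le> 20 \<and> search_inv n \<sigma>) (r', m)" if r': "regs_ok r'" "r' 5 = int cmax" for r'
  proof -
    have regs: "r' 2 = int k" "r' 5 = int cmax" using r' by (auto simp: regs_ok_def)
    have prod: "\<bar>- int k * int cmax\<bar> \<le> W" "\<bar>int k * int cmax\<bar> \<le> W"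
    proof -
      have "0 \<le> int k * int cmax" by simp
      then have "- int k * int cmax \<le> int cmax + 1" by linarith
      then show "\<bar>- int k * int cmax\<bar> \<le> W" "\<bar>int k * int cmax\<bar> \<le> W"
        using penalty_bound[of "- int k * int cmax"] word_bounds by auto
    qed
    have fits: "\<bar>r' 2\<bar> \<le> W" "\<bar>r' 5\<bar> \<le> W" "\<bar>r' 5 + 1\<bar> \<le> W" "1 \<le> W" "0 \<le> W"
      "\<bar>r' 2 * r' 5\<bar> \<le> W" 
      using prod word_bounds N unfolding regs by linarith+
    \<comment> \<open>This number is the length of the starting interval from
      \<open>- k * cmax\<close> to \<open>cmax + 1\<close>.\<close>
    have "int ((k + 1) * cmax + 1) \<le> int (2 ^ n)" using n by (simp only: of_nat_le_iff)
    then have n': "int cmax + 1 - (- int k * int cmax) \<le> 2 ^ n" by (simp add: algebra_simps)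
    have "0 \<le> int k * int cmax" by simp
    then have "- (int k * int cmax) \<le> int cmax" by linarith
    then have "search_inv n (r'(7 := - (r' 2 * r' 5), 8 := r' 5 + 1), m)"
      using cnt_low cnt_high n' m r'(1)
      unfolding search_inv_def by (simp add: regs regs_ok_upd)
    then show ?thesis
      by (intro wp_Seq wp_Assign; simp add: fits)
  qed
  show ?thesis
    unfolding setup_prog_def input
  proof (rule wp_Seq_le)
    show "wp W (Assign 10 (Add (Reg 1) (Num 1)))
        (\<lambda>t \<sigma>. t \<le> 4 \<and> \<sigma> = (r(10 := int (d + 1)), m)) (r, m)"
      by (rule wp_Assign) (use word_bounds N r0 in auto)
    show "wp W (Seq (Assign 11 (Add (Reg 1) (Reg 0))) (Seq (Assign 6 (Num 1)) (Seq (While ?p max_body)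
       (Seq (Assign 7 (Sub (Num 0) (Mul (Reg 2) (Reg 5)))) (Assign 8 (Add (Reg 5) (Num 1)))))))
       (\<lambda>t \<sigma>. t \<le> 26 + 28 * d \<and> search_inv n \<sigma>) \<sigma>"
      if "\<sigma> = (r(10 := int (d + 1)), m)" for \<sigma>
    proof (rule wp_Seq_le)
      show "wp W (Assign 11 (Add (Reg 1) (Reg 0))) (\<lambda>t \<sigma>. t \<le> 4 \<and> \<sigma> = (?r, m)) \<sigma>"
        unfolding that by (rule wp_Assign) (use word_bounds N r0 in auto)
      show "wp W (Seq (Assign 6 (Num 1)) (Seq (While ?p max_body)
         (Seq (Assign 7 (Sub (Num 0) (Mul (Reg 2) (Reg 5)))) (Assign 8 (Add (Reg 5) (Num 1))))))
         (\<lambda>t \<sigma>. t \<le> 22 + 28 * d \<and> search_inv n \<sigma>) \<sigma>"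
        if "\<sigma> = (?r, m)" for \<sigma>
      proof (rule wp_Seq_le)
        show "wp W (Assign 6 (Num 1)) (\<lambda>t \<sigma>. t \<le> 2 \<and> \<sigma> = (?r(6 := 1), m)) \<sigma>"
          unfolding that by (rule wp_Assign) (use word_bounds in auto)
        show "wp W (Seq (While ?p max_body)
           (Seq (Assign 7 (Sub (Num 0) (Mul (Reg 2) (Reg 5)))) (Assign 8 (Add (Reg 5) (Num 1)))))
           (\<lambda>t \<sigma>. t \<le> 20 + 28 * d \<and> search_inv n \<sigma>) \<sigma>"
          if "\<sigma> = (?r(6 := 1), m)" for \<sigma>
          unfolding that by (rule wp_Seq_le[OF loop, where U = 20]) (use range in auto)
      qed simp
    qed simp
    show "4 + (26 + 28 * d) \<le> 100 * d" using s se ed by simp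
  qed
qed

lemma search_body_wp:
  assumes inv: "search_inv (Suc n) (r, m)" and gt: "r 7 + 1 < r 8"
  shows "wp W search_body (\<lambda>t \<sigma>. t \<le> 300 * d \<and> search_inv n \<sigma>) (r, m)"
proof -
  define \<mu> where "\<mu> = (r 7 + r 8) div 2"
  have r: "regs_ok r" and m: "mem_ok m"
    and range: "- int k * int cmax \<le> r 7" "r 8 \<le> int cmax + 1" "r 8 - r 7 \<le> 2 * 2 ^ n"
    and cnt: "k \<le> cntL (r 7) + cntR (r 7)" "cntL (r 8) + cntR (r 8) \<le> k"
    using inv by (auto simp: search_inv_def)
  \<comment> \<open>Rounding down makes the upper half the longer one; it still fits because the
    bound \<open>2 * 2 ^ n\<close> is even. The loop guard keeps the midpoint strictly
    inside.\<close>
  have mid: "r 7 < \<mu>" "\<mu> < r 8" "\<mu> - r 7 \<le> 2 ^ n" "r 8 - \<mu> \<le> 2 ^ n"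
    using gt range(3) unfolding \<mu>_def by linarith+
  have \<mu>: "\<bar>\<mu>\<bar> \<le> N ^ 2" "\<bar>r 7\<bar> \<le> N ^ 2" "\<bar>r 8\<bar> \<le> N ^ 2"
    using mid range by (intro penalty_bound; linarith)+
  have r': "regs_ok (r(9 := \<mu>))" using r by (simp add: regs_ok_upd)
  show ?thesis
    unfolding search_body_def
  proof (rule wp_Seq_le)
    show "wp W (Assign 9 (Div (Add (Reg 7) (Reg 8)) (Num 2)))
        (\<lambda>t \<sigma>. t \<le> 6 \<and> \<sigma> = (r(9 := \<mu>), m)) (r, m)"
    proof (rule wp_Assign)
      have "\<bar>r 7 + r 8\<bar> \<le> W" "\<bar>r 7\<bar> \<le> W" "\<bar>r 8\<bar> \<le> W" "\<bar>\<mu>\<bar> \<le> W" "2 \<le> W"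
        using \<mu> word_bounds by linarith+
      then show "fits W (Div (Add (Reg 7) (Reg 8)) (Num 2)) (r, m)" by (simp add: \<mu>_def)
    qed (simp add: \<mu>_def)
    show "wp W (Seq dp (Cond (Less (Add (remainder left_opt) (remainder right_opt)) (Reg 2))
        (Assign 8 (Reg 9)) (Assign 7 (Reg 9)))) (\<lambda>t \<sigma>. t \<le> 200 * d + 60 \<and> search_inv n \<sigma>) \<sigma>"
      if "\<sigma> = (r(9 := \<mu>), m)" for \<sigma>
      unfolding that
    proof (rule wp_Seq_le[OF dp_wp[OF r' _ \<mu>(1) m]])
      fix \<sigma> assume "dp_post \<mu> (r(9 := \<mu>)) \<sigma>"
      then obtain r1 m1 where \<sigma>: "\<sigma> = (r1, m1)" and r1: "\<And>x. x \<noteq> 6 \<Longrightarrow> x \<noteq> 12 \<Longrightarrow> r1 x = (r(9 := \<mu>)) x"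
        and m1: "mem_ok m1" and dp: "\<forall>j \<le> d. m1 (int (d + \<Delta> + j)) = g \<mu> j"
        by (cases \<sigma>) (auto simp: dp_post_def)
      have ok: "regs_ok r1" by (rule regs_ok_cong[OF r']) (use r1 in auto)
      have regs: "r1 7 = r 7" "r1 8 = r 8" "r1 9 = \<mu>" "r1 2 = int k"
        using r1 ok by (auto simp: regs_ok_def)
      note cnts = after_dp[OF ok \<mu>(1) dp]
      have fits: "int k \<le> W" "int (cntL \<mu>) + int (cntR \<mu>) \<le> W" "\<bar>\<mu>\<bar> \<le> W" "\<bar>int (cntL \<mu>) + int (cntR \<mu>)\<bar> \<le> W"
        using cnts(5,6) \<mu> word_bounds N by linarith+
      have high: "search_inv n (r1(8 := \<mu>), m1)" if "cntL \<mu> + cntR \<mu> \<le> k"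
        using that ok m1 mid range cnt
        unfolding search_inv_def by (simp add: regs regs_ok_upd)
      have low: "search_inv n (r1(7 := \<mu>), m1)" if "k \<le> cntL \<mu> + cntR \<mu>"
        using that ok m1 mid range cnt
        unfolding search_inv_def by (simp add: regs regs_ok_upd)
      show "wp W (Cond (Less (Add (remainder left_opt) (remainder right_opt)) (Reg 2))
        (Assign 8 (Reg 9)) (Assign 7 (Reg 9))) (\<lambda>t \<sigma>. t \<le> 60 \<and> search_inv n \<sigma>) \<sigma>"
        unfolding \<sigma>
        by (intro wp_Cond wp_Assign; simp add: cnts(1-4) remainder_cost regs fits high low)
    qed auto
    show "6 + (200 * d + 60) \<le> 300 * d" using s se ed by simp
  qed
qed

lemma split_budget_wp:
  assumes inv: "search_inv n (r, m)" and stop: "\<not> r 7 + 1 < r 8"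
  shows "wp W split_budget (\<lambda>t \<sigma>. t \<le> 600 * d \<and> (\<exists>kL kR. outputs \<sigma> kL kR \<and>
    (\<exists>S. optimal_separated_solution \<Delta> d (masked_cost c s e) k S \<and>
      card {i \<in> S. i < s} = kL \<and> card {i \<in> S. i > e} = kR))) (r, m)"
    (is "wp _ _ (\<lambda>t \<sigma>. t \<le> _ \<and> ?Q \<sigma>) _")
proof -
  define \<mu> where "\<mu> = r 7"
  have r: "regs_ok r" and m: "mem_ok m" and r8: "r 8 = \<mu> + 1"
    and range: "- int k * int cmax \<le> \<mu>" "\<mu> + 1 \<le> int cmax + 1"
    and cnt: "k \<le> cntL \<mu> + cntR \<mu>" "cntL (\<mu> + 1) + cntR (\<mu> + 1) \<le> k"
    using inv stop by (auto simp: search_inv_def \<mu>_def) (smt (verit))+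
  have \<mu>: "\<bar>\<mu>\<bar> \<le> N ^ 2" "\<bar>\<mu> + 1\<bar> \<le> N ^ 2"
    using range by (intro penalty_bound; linarith)+
  have \<mu>W: "\<bar>\<mu>\<bar> \<le> W" "\<bar>\<mu> + 1\<bar> \<le> W"
    using \<mu> word_bounds by linarith+
  have r': "regs_ok (r(9 := \<mu> + 1))" using r by (simp add: regs_ok_upd)
  define kL where "kL = max (cntL (\<mu> + 1)) (k - cntR \<mu>)"
  have kL: "kL \<le> k" "\<exists>S. optimal_separated_solution \<Delta> d (masked_cost c s e) k S \<and>
      card {i \<in> S. i < s} = kL \<and> card {i \<in> S. i > e} = k - kL"
    using split_optimal[OF cnt] unfolding kL_def by blast+
  \<comment> \<open>The program subtracts integers while \<open>kL\<close> uses truncated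
    subtraction. When \<open>k < cntR \<mu>\<close> the results differ, but neither exceeds
    \<open>cntL (\<mu> + 1)\<close>, so the maximum is the same.\<close>
  have kL_int: "int kL = (if int (cntL (\<mu> + 1)) < int k - int (cntR \<mu>) then int k - int (cntR \<mu>) else int (cntL (\<mu> + 1)))"
    unfolding kL_def by auto
  have out: "?Q \<sigma>" if "fst \<sigma> 0 = int kL" "fst \<sigma> 1 = int k - int kL" for \<sigma>
    using that kL by (intro exI[of _ kL] exI[of _ "k - kL"]) (auto simp: outputs_def)
  let ?c4 = "Seq (Cond (Less (Reg 13) (Sub (Reg 2) (Reg 12))) (Assign 13 (Sub (Reg 2) (Reg 12))) Skip)
     (Seq (Assign 0 (Reg 13)) (Assign 1 (Sub (Reg 2) (Reg 13))))"
  let ?c3 = "Seq (Assign 12 (remainder right_opt)) ?c4"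
  let ?c2 = "Seq (Assign 13 (remainder left_opt)) (Seq (Assign 9 (Reg 7)) (Seq dp ?c3))"
  have c3: "wp W ?c3 (\<lambda>t \<sigma>. t \<le> 60 \<and> ?Q \<sigma>) (r1, m1)"
    if "regs_ok r1" "r1 13 = int (cntL (\<mu> + 1))" "\<forall>j \<le> d. m1 (int (d + \<Delta> + j)) = g \<mu> j" for r1 m1
  proof -
    note cnts = after_dp[OF that(1) \<mu>(1) that(3)]
    have r2: "r1 2 = int k" using that(1) by (simp add: regs_ok_def)
    have "cntL (\<mu> + 1) \<le> k" using cnt(2) by simp
    then have fits: "int k \<le> W" "int (cntR \<mu>) \<le> W" "int (cntL (\<mu> + 1)) \<le> W"
      "int k - int (cntR \<mu>) \<le> W"
      "\<bar>int k - int (cntR \<mu>)\<bar> \<le> W" "\<bar>int k - int (cntL (\<mu> + 1))\<bar> \<le> W" 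
      "\<bar>int k - (int k - int (cntR \<mu>))\<bar> \<le> W"
      using cnts(6) word_bounds N by linarith+
    show ?thesis
      by (intro wp_Seq wp_Cond wp_Assign wp_Skip conjI out;
          simp add: cnts(3,4) remainder_cost r2 that(2) fits kL_int)
  qed
  have c2: "wp W ?c2 (\<lambda>t \<sigma>. t \<le> 100 + 200 * d \<and> ?Q \<sigma>) (r1, m1)"
    if ok: "regs_ok r1" and r7: "r1 7 = \<mu>" and m1: "mem_ok m1"
      and dp1: "\<forall>j \<le> d. m1 (int (d + \<Delta> + j)) = g (\<mu> + 1) j" for r1 m1
  proof -
    note cnts = after_dp[OF ok \<mu>(2) dp1]
    \<comment> \<open>\<open>dp\<close> changes only registers 6 and 12, so the left size survives
      the second pass in register 13.\<close>
    let ?r1 = "r1(13 := int (cntL (\<mu> + 1)), 9 := \<mu>)"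
    have ok1: "regs_ok ?r1" using ok by (simp add: regs_ok_upd)
    show ?thesis
    proof (rule wp_Seq_le)
      show "wp W (Assign 13 (remainder left_opt))
          (\<lambda>t \<sigma>. t \<le> 18 \<and> \<sigma> = (r1(13 := int (cntL (\<mu> + 1))), m1)) (r1, m1)"
        by (rule wp_Assign) (use cnts remainder_cost in auto)
      show "wp W (Seq (Assign 9 (Reg 7)) (Seq dp ?c3)) (\<lambda>t \<sigma>. t \<le> 80 + 200 * d \<and> ?Q \<sigma>) \<sigma>"
        if "\<sigma> = (r1(13 := int (cntL (\<mu> + 1))), m1)" for \<sigma>
        unfolding that
      proof (rule wp_Seq_le)
        show "wp W (Assign 9 (Reg 7)) (\<lambda>t \<sigma>. t \<le> 2 \<and> \<sigma> = (?r1, m1)) (r1(13 := int (cntL (\<mu> + 1))), m1)"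
          by (rule wp_Assign) (use r7 \<mu>W in auto)
        show "wp W (Seq dp ?c3) (\<lambda>t \<sigma>. t \<le> 70 + 200 * d \<and> ?Q \<sigma>) \<sigma>" if "\<sigma> = (?r1, m1)" for \<sigma>
          unfolding that
        proof (rule wp_Seq_le[OF dp_wp[OF ok1 _ \<mu>(1) m1]])
          fix \<sigma> assume post: "dp_post \<mu> ?r1 \<sigma>"
          have "regs_ok (fst \<sigma>)"
            by (rule regs_ok_cong[OF ok1]) (use post in \<open>auto simp: dp_post_def\<close>)
          then show "wp W ?c3 (\<lambda>t \<sigma>. t \<le> 60 \<and> ?Q \<sigma>) \<sigma>"
            using post c3[of "fst \<sigma>" "snd \<sigma>"] by (auto simp: dp_post_def)
        qed auto
      qed simp
    qed simp
  qed
  show ?thesis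
    unfolding split_budget_def
  proof (rule wp_Seq_le)
    show "wp W (Assign 9 (Reg 8)) (\<lambda>t \<sigma>. t \<le> 2 \<and> \<sigma> = (r(9 := \<mu> + 1), m)) (r, m)"
      by (rule wp_Assign) (use r8 \<mu>W in auto)
    show "wp W (Seq dp ?c2) (\<lambda>t \<sigma>. t \<le> 400 * d + 100 \<and> ?Q \<sigma>) \<sigma>" if "\<sigma> = (r(9 := \<mu> + 1), m)" for \<sigma>
      unfolding that
    proof (rule wp_Seq_le[OF dp_wp[OF r' _ \<mu>(2) m]])
      fix \<sigma> assume post: "dp_post (\<mu> + 1) (r(9 := \<mu> + 1)) \<sigma>"
      have "regs_ok (fst \<sigma>)"
        by (rule regs_ok_cong[OF r']) (use post in \<open>auto simp: dp_post_def\<close>)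
      moreover have "fst \<sigma> 7 = \<mu>" using post by (simp add: dp_post_def \<mu>_def)
      ultimately show "wp W ?c2 (\<lambda>t \<sigma>. t \<le> 100 + 200 * d \<and> ?Q \<sigma>) \<sigma>"
        using post c2[of "fst \<sigma>" "snd \<sigma>"] by (auto simp: dp_post_def)
    qed auto
    show "2 + (400 * d + 100) \<le> 600 * d" using s se ed by simp
  qed
qed


lemma search_wp:
  assumes "search_inv n \<sigma>"
  shows "wp W search (\<lambda>t \<sigma>. t \<le> 306 * d * n + 6 \<and> (\<exists>n. search_inv n \<sigma>) \<and> \<not> fst \<sigma> 7 + 1 < fst \<sigma> 8) \<sigma>"
proof -
  let ?p = "Less (Add (Reg 7) (Num 1)) (Reg 8)"
  have fit: "bfits W ?p \<sigma>" if inv: "search_inv n \<sigma>" for n \<sigma>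
  proof -
    obtain r m where \<sigma>: "\<sigma> = (r, m)" by force
    have range: "- int k * int cmax \<le> r 7" "r 7 < r 8" "r 8 \<le> int cmax + 1"
      using inv by (auto simp: search_inv_def \<sigma>)
    then have "\<bar>r 7\<bar> \<le> N ^ 2" "\<bar>r 7 + 1\<bar> \<le> N ^ 2" "\<bar>r 8\<bar> \<le> N ^ 2"
      by (intro penalty_bound; linarith)+
    then have "\<bar>r 7\<bar> \<le> W" "\<bar>r 7 + 1\<bar> \<le> W" "\<bar>r 8\<bar> \<le> W" "1 \<le> W"
      using word_bounds by linarith+
    then show ?thesis by (simp add: \<sigma>)
  qed
  have body: "\<exists>n'. n = Suc n' \<and> wp W search_body (\<lambda>t \<sigma>'. t \<le> 300 * d \<and> search_inv n' \<sigma>') \<sigma>"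
    if inv: "search_inv n \<sigma>" and p: "bval ?p \<sigma>" for n \<sigma>
  proof -
    obtain r m where \<sigma>: "\<sigma> = (r, m)" by force
    have gt: "r 7 + 1 < r 8" using p by (simp add: \<sigma>)
    have "r 8 - r 7 \<le> 2 ^ n" using inv by (simp add: \<sigma> search_inv_def)
    then obtain n' where "n = Suc n'" using gt by (cases n) auto
    then show ?thesis using search_body_wp gt inv unfolding \<sigma> by blast
  qed
  have time: "n * (1 + bcost ?p + 300 * d) + (1 + bcost ?p) \<le> 306 * d * n + 6"
    using mult_le_mono2[of 1 d n] s se ed by (simp add: algebra_simps)
  show ?thesis
    unfolding search_def
  proof (rule wp_mono[OF wp_While[where I = search_inv, OF assms fit body]])
    fix t \<sigma>'
    assume "t \<le> n * (1 + bcost ?p + 300 * d) + (1 + bcost ?p) \<and> \<not> bval ?p \<sigma>' \<and> (\<exists>n. search_inv n \<sigma>')"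
    then have "t \<le> 306 * d * n + 6" "\<not> bval ?p \<sigma>'" "\<exists>n. search_inv n \<sigma>'"
      using time by (blast intro: order_trans)+
    then show "t \<le> 306 * d * n + 6 \<and> (\<exists>n. search_inv n \<sigma>') \<and> \<not> fst \<sigma>' 7 + 1 < fst \<sigma>' 8"
      by simp
  qed
qed

section \<open>Assembling the algorithm and its running time\<close>

definition solved :: "state \<Rightarrow> bool" where
  "solved \<sigma> \<longleftrightarrow> (\<exists>kL kR. outputs \<sigma> kL kR \<and>
     (\<exists>S. optimal_separated_solution \<Delta> d (masked_cost c s e) k S \<and>
       card {i \<in> S. i < s} = kL \<and> card {i \<in> S. i > e} = kR))"

lemma algorithm_wp:
  assumes "(k + 1) * cmax + 1 \<le> 2 ^ n"
  shows "wp W (Seq setup_prog (Seq search split_budget))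
    (\<lambda>t \<sigma>. t \<le> 1000 * d * (n + 1) \<and> solved \<sigma>) (input_state \<Delta> d k s e c)"
proof (rule wp_Seq_le[OF setup_wp[OF assms]], rule wp_Seq_le[OF search_wp])
  fix \<sigma> assume "(\<exists>n. search_inv n \<sigma>) \<and> \<not> fst \<sigma> 7 + 1 < fst \<sigma> 8"
  then show "wp W split_budget (\<lambda>t \<sigma>. t \<le> 600 * d \<and> solved \<sigma>) \<sigma>"
    using split_budget_wp[of _ "fst \<sigma>" "snd \<sigma>"] unfolding solved_def by auto
next
  show "100 * d + (306 * d * n + 6 + 600 * d) \<le> 1000 * d * (n + 1)"
    using s se ed by (simp add: algebra_simps)
qed auto

end

text \<open>With \<open>cmax\<close> and \<open>k\<close> clamped below at 1, the interval length is
  at most four times their product. The 4 adds 2 to the logarithm, rounding up and the final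
  \<open>+ 1\<close> add at most 2 more, and the clamped logarithms are non-negative; hence the
  factor 4.\<close>

lemma search_depth:
  fixes k cmax :: nat
  obtains n where "(k + 1) * cmax + 1 \<le> 2 ^ n"
    "real (n + 1) \<le> 4 * (1 + log 2 (max 1 (real cmax)) + log 2 (max 1 (real k)))"
proof -
  define a b where "a = max 1 (real cmax)" and "b = max 1 (real k)"
  have ab: "1 \<le> a" "1 \<le> b" "real cmax \<le> a" "real k \<le> b" by (auto simp: a_def b_def)
  define n where "n = nat \<lceil>log 2 (4 * a * b)\<rceil>"
  have "1 * 1 \<le> a * b" using ab by (intro mult_mono) auto
  then have pos: "0 < 4 * a * b" "1 \<le> 4 * a * b" by linarith+
  have "(real k + 1) * real cmax \<le> (2 * b) * a"
    using ab by (intro mult_mono) auto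
  then have "real ((k + 1) * cmax + 1) \<le> 4 * a * b"
    using \<open>1 * 1 \<le> a * b\<close> by (simp add: algebra_simps)
  also have "\<dots> = 2 powr log 2 (4 * a * b)" using pos by simp
  also have "\<dots> \<le> 2 powr real n"
    unfolding n_def by (intro powr_mono) (auto simp: real_nat_ceiling_ge)
  also have "\<dots> = real (2 ^ n)" by (simp add: powr_realpow)
  finally have "(k + 1) * cmax + 1 \<le> 2 ^ n" by (simp only: of_nat_le_iff)
  moreover have log: "log 2 (4 * a * b) = 2 + log 2 a + log 2 b"
    using ab log_pow_cancel[of 2 2] by (simp add: log_mult)
  have "0 \<le> log 2 a" "0 \<le> log 2 b" using ab by simp_all
  then have "real n \<le> log 2 (4 * a * b) + 1" "0 \<le> log 2 (4 * a * b)"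
    unfolding n_def using log by (simp_all add: of_nat_nat le_nat_iff) linarith
  then have "real (n + 1) \<le> 4 * (1 + log 2 a + log 2 b)"
    using log \<open>0 \<le> log 2 a\<close> \<open>0 \<le> log 2 b\<close> by simp
  ultimately show thesis using that unfolding a_def b_def by blast
qed

theorem theorem11:
  "\<exists>(P :: com) (C :: nat).
     \<forall>(\<Delta> :: nat) (d' :: nat) (c' :: nat \<Rightarrow> nat) (k'' :: nat) (s :: nat) (e :: nat) (c'max :: nat).
       \<Delta> \<ge> 1 \<longrightarrow> 1 \<le> s \<longrightarrow> s \<le> e \<longrightarrow> e \<le> d' \<longrightarrow>
       (e - s + 1 \<ge> \<Delta> \<or> e = d') \<longrightarrow>
       (\<exists>S. separated_solution \<Delta> d' k'' S \<and> S \<inter> {s..e} = {}) \<longrightarrow>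
       c'max = Max (c' ` {1..d'}) \<longrightarrow>
       (\<exists>t \<sigma> k'\<^sub>L k'\<^sub>R.
          exec ((2 + int \<Delta> + int d' + int k'' + int c'max) ^ C) P (input_state \<Delta> d' k'' s e c') t \<sigma> \<and>
          outputs \<sigma> k'\<^sub>L k'\<^sub>R \<and>
          real t \<le> real C * real d' * (1 + log 2 (max 1 (real c'max)) + log 2 (max 1 (real k''))) \<and>
          (\<exists>S. optimal_separated_solution \<Delta> d' (masked_cost c' s e) k'' S \<and>
               card {i \<in> S. i < s} = k'\<^sub>L \<and> card {i \<in> S. i > e} = k'\<^sub>R))"
proof (rule exI[of _ "Seq setup_prog (Seq search split_budget)"], rule exI[of _ 4000], intro allI impI)
  fix \<Delta> d' :: nat and c' :: "nat \<Rightarrow> nat" and k'' s e c'max :: nat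
  assume asms: "\<Delta> \<ge> 1" "1 \<le> s" "s \<le> e" "e \<le> d'" "e - s + 1 \<ge> \<Delta> \<or> e = d'"
    "\<exists>S. separated_solution \<Delta> d' k'' S \<and> S \<inter> {s..e} = {}" "c'max = Max (c' ` {1..d'})"
  define N where "N = 2 + int \<Delta> + int d' + int k'' + int c'max"
  \<comment> \<open>4000 is the 1000 of \<open>algorithm_wp\<close> times the 4 of
    \<open>search_depth\<close>. The same constant serves as exponent of the word bound, where it
    only has to be at least 6.\<close>
  interpret instance_data \<Delta> d' k'' s e c' c'max "N ^ 4000" N
    by unfold_locales (use asms in \<open>auto simp: N_def intro: power_increasing\<close>)
  obtain n where n: "(k'' + 1) * c'max + 1 \<le> 2 ^ n"
      "real (n + 1) \<le> 4 * (1 + log 2 (max 1 (real c'max)) + log 2 (max 1 (real k'')))"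
    by (rule search_depth)
  obtain t \<sigma> where run: "exec (N ^ 4000) (Seq setup_prog (Seq search split_budget))
      (input_state \<Delta> d' k'' s e c') t \<sigma>" "t \<le> 1000 * d' * (n + 1)" "solved \<sigma>"
    using algorithm_wp[OF n(1)] unfolding wp_def by blast
  have "real t \<le> real (1000 * d' * (n + 1))" using run(2) by (simp only: of_nat_le_iff)
  also have "\<dots> = 1000 * real d' * real (n + 1)" by (simp add: algebra_simps)
  also have "\<dots> \<le> 1000 * real d' * (4 * (1 + log 2 (max 1 (real c'max)) + log 2 (max 1 (real k''))))"
    using n(2) by (intro mult_left_mono) auto
  finally have "real t \<le> real 4000 * real d' * (1 + log 2 (max 1 (real c'max)) + log 2 (max 1 (real k'')))"
    by (simp add: algebra_simps)
  then show "\<exists>t \<sigma> k'\<^sub>L k'\<^sub>R.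
          exec ((2 + int \<Delta> + int d' + int k'' + int c'max) ^ 4000) (Seq setup_prog (Seq search split_budget))
            (input_state \<Delta> d' k'' s e c') t \<sigma> \<and>
          outputs \<sigma> k'\<^sub>L k'\<^sub>R \<and>
          real t \<le> real 4000 * real d' * (1 + log 2 (max 1 (real c'max)) + log 2 (max 1 (real k''))) \<and>
          (\<exists>S. optimal_separated_solution \<Delta> d' (masked_cost c' s e) k'' S \<and>
               card {i \<in> S. i < s} = k'\<^sub>L \<and> card {i \<in> S. i > e} = k'\<^sub>R)"
    using run(1,3) unfolding solved_def N_def by blast
qed

end
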